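(* For each $n$, let $\pi$ be a uniformly random permutation in $S_n$, and let $M_n=\mathrm{pk}(\pi)+1$ and $M'_n=\mathrm{pk}(\pi^{-1})+1$. Let $\mu_n=\frac{n+1}{3}$ and $\sigma_n^2=\frac{2(n+1)}{45}$, with $\sigma_n>0$. Then, as $n\to\infty$, \[ \left(\frac{M_n-\mu_n}{\sigma_n},\ \frac{M'_n-\mu_n}{\sigma_n}\right)\Longrightarrow N(0,I_2), \] where $\Longrightarrow$ denotes convergence in distribution and $N(0,I_2)$ is the standard bivariate normal distribution (mean zero, identity covariance matrix).
   Context: Let $S_n$ be the symmetric group of permutations of $\{1,\dots,n\}$. A permutation $\pi\in S_n$ has a peak at position $i$, where $2\le i\le n-1$, if $\pi(i-1)<\pi(i)>\pi(i+1)$. Let $\mathrm{pk}(\pi)$ denote the number of peaks of $\pi$. *)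

theory Defs
  imports "HOL-Probability.Probability" "HOL-Combinatorics.Permutations"
begin

definition peaks :: "nat \<Rightarrow> (nat \<Rightarrow> nat) \<Rightarrow> nat set" where
  "peaks n \<pi> = {i \<in> {2..n - 1}. \<pi> (i - 1) < \<pi> i \<and> \<pi> i > \<pi> (i + 1)}"

definition pk :: "nat \<Rightarrow> (nat \<Rightarrow> nat) \<Rightarrow> nat" where
  "pk n \<pi> = card (peaks n \<pi>)"

definition uniform_perm :: "nat \<Rightarrow> (nat \<Rightarrow> nat) pmf" where
  "uniform_perm n = pmf_of_set {\<pi>. \<pi> permutes {1..n}}"

text \<open>
  The library's \<open>weak_conv_m\<close> is restricted to measures on the real line. For measures on a
  general topological space we use the definition by bounded continuous test functions; the
  lemma after it shows that the two notions agree on real distributions.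
\<close>

definition weak_conv_meas ::
    "(nat \<Rightarrow> 'a::topological_space measure) \<Rightarrow> 'a measure \<Rightarrow> bool" where
  "weak_conv_meas \<mu> \<nu> \<longleftrightarrow>
     (\<forall>f :: 'a \<Rightarrow> real. continuous_on UNIV f \<longrightarrow> bounded (range f) \<longrightarrow>
        (\<lambda>n. integral\<^sup>L (\<mu> n) f) \<longlonglongrightarrow> integral\<^sup>L \<nu> f)"

lemma weak_conv_meas_real_iff:
  assumes "\<And>n. real_distribution (\<mu> n)" "real_distribution \<nu>"
  shows "weak_conv_meas \<mu> \<nu> \<longleftrightarrow> weak_conv_m \<mu> \<nu>"
proof
  assume w: "weak_conv_meas \<mu> \<nu>"
  show "weak_conv_m \<mu> \<nu>"
  proof (rule integral_bdd_continuous_conv_imp_weak_conv[OF assms])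
    fix f :: "real \<Rightarrow> real" assume f: "\<And>x. isCont f x" "\<And>x. \<bar>f x\<bar> \<le> 1"
    then have "bounded (range f)" by (auto simp: bounded_iff)
    with f w show "(\<lambda>n. integral\<^sup>L (\<mu> n) f) \<longlonglongrightarrow> integral\<^sup>L \<nu> f"
      by (auto simp: weak_conv_meas_def continuous_on_eq_continuous_at)
  qed
next
  assume w: "weak_conv_m \<mu> \<nu>"
  show "weak_conv_meas \<mu> \<nu>"
    unfolding weak_conv_meas_def
  proof (intro allI impI)
    fix f :: "real \<Rightarrow> real" assume f: "continuous_on UNIV f" "bounded (range f)"
    then obtain B where "\<And>x. norm (f x) \<le> B" by (auto simp: bounded_iff)
    with f show "(\<lambda>n. integral\<^sup>L (\<mu> n) f) \<longlonglongrightarrow> integral\<^sup>L \<nu> f"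
      by (intro weak_conv_imp_integral_bdd_continuous_conv[OF assms w])
         (auto simp: continuous_on_eq_continuous_at)
  qed
qed

definition std_normal2 :: "(real \<times> real) measure" where
  "std_normal2 = density lborel (\<lambda>(x, y). ennreal (exp (- (x\<^sup>2 + y\<^sup>2) / 2) / (2 * pi)))"

lemma std_normal2_eq_pair:
  "std_normal2 = std_normal_distribution \<Otimes>\<^sub>M std_normal_distribution"
proof -
  interpret prob_space std_normal_distribution
    by (rule prob_space_normal_density) simp
  have "std_normal_distribution \<Otimes>\<^sub>M std_normal_distribution =
      density (lborel \<Otimes>\<^sub>M lborel)
        (\<lambda>(x, y). ennreal (std_normal_density x) * ennreal (std_normal_density y))"
    by (intro pair_measure_density sigma_finite_lborel sigma_finite_measure_axioms) auto
  also have "\<dots> = std_normal2"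
    unfolding std_normal2_def lborel_prod
  proof (rule arg_cong[where f = "density lborel"], rule ext, clarify)
    fix x y :: real
    have "std_normal_density x * std_normal_density y = exp (- (x\<^sup>2 + y\<^sup>2) / 2) / (2 * pi)"
      by (simp add: std_normal_density_def exp_add[symmetric] add_divide_distrib diff_divide_distrib)
    then show "ennreal (std_normal_density x) * ennreal (std_normal_density y) =
        ennreal (exp (- (x\<^sup>2 + y\<^sup>2) / 2) / (2 * pi))"
      by (simp add: ennreal_mult'[symmetric] normal_density_nonneg)
  qed
  finally show ?thesis ..
qed

end

theory Submission
  imports Defs
begin

text \<open>
  Write \<open>S = pk \<pi> - (n - 2)/3\<close> for the centred number of peaks of a uniformly random permutation
  and \<open>S'\<close> for the same statistic of the inverse permutation; the two coordinates of the random
  vector are \<open>X = S/\<sigma>\<close> and \<open>Y = S'/\<sigma>\<close>. The joint characteristic function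
  \<open>\<phi>(s, t) = E exp(\<i>(s X + t Y))\<close> is shown to satisfy Stein's differential equation for the normal
  law in its first variable, \<open>\<partial>\<phi>/\<partial>s = - s \<phi>\<close>, up to an error that vanishes as \<open>n\<close> grows.

  The statistic \<open>S\<close> is a sum of local terms \<open>a\<^sub>i = [i is a peak] - 1/3\<close>. Position \<open>i\<close> is a peak iff
  the largest of the three values at \<open>i - 1, i, i + 1\<close> stands in the middle, and permuting these
  positions at random leaves the uniform distribution unchanged. So \<open>a\<^sub>i\<close> has mean zero against
  every factor that does not notice such permutations, in particular against functions of the
  \<open>a\<^sub>j\<close> with \<open>|i - j| > 2\<close>. Let \<open>A\<^sub>i\<close> be the sum of the \<open>a\<^sub>j\<close> with \<open>|i - j| \<le> 2\<close>. Expanding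
  \<open>exp(\<i> r S)\<close> around \<open>exp(\<i> r (S - A\<^sub>i))\<close>, summing over \<open>i\<close>, and using that
  \<open>\<Sum> a\<^sub>i A\<^sub>i\<close> concentrates around its mean \<open>\<sigma>\<^sup>2\<close>, one obtains the differential equation for the
  characteristic function of \<open>X\<close> (\<open>peak_cf_stein_bound\<close>).

  The factor \<open>exp(\<i> t Y)\<close> may be carried along for free, and this is why the two statistics are
  asymptotically independent. Swapping two adjacent positions of \<open>\<pi>\<close> swaps two adjacent values of the
  inverse; this can change its peaks only if these two values stand next to each other there, which
  happens with probability \<open>2/n\<close>, and then it changes at most two peaks. Summed over all positions, the
  effect on \<open>exp(\<i> t Y)\<close> is \<open>O(1/\<sigma>)\<close>, which is negligible (\<open>perm_avg_inv_cf_transpose_diff\<close>).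

  Integrating the differential equation from \<open>0\<close> to \<open>s\<close> gives \<open>\<phi>(s, t) \<approx> exp(-s\<^sup>2/2) \<phi>(0, t)\<close>. Since
  \<open>\<pi>\<close> and its inverse have the same distribution, \<open>\<phi>(0, t) = \<phi>(t, 0) \<approx> exp(-t\<^sup>2/2)\<close>. The theorem follows
  from a continuity theorem for characteristic functions in the plane (\<open>levy_continuity_plane\<close>).
\<close>

section \<open>Averages over all permutations\<close>

definition perm_avg :: "nat \<Rightarrow> ((nat \<Rightarrow> nat) \<Rightarrow> 'a::real_normed_vector) \<Rightarrow> 'a" where
  "perm_avg n F = (\<Sum>\<pi> | \<pi> permutes {1..n}. F \<pi>) /\<^sub>R fact n"

lemma finite_perms: "finite {\<pi>. \<pi> permutes {1..n::nat}}"
  by (intro finite_permutations) simp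

lemma card_perms: "card {\<pi>. \<pi> permutes {1..n::nat}} = fact n"
  by (rule card_permutations) auto

lemma perm_avg_cong:
  assumes "\<And>\<pi>. \<pi> permutes {1..n} \<Longrightarrow> F \<pi> = G \<pi>"
  shows "perm_avg n F = perm_avg n G"
  using assms by (simp add: perm_avg_def)

lemma perm_avg_add: "perm_avg n (\<lambda>\<pi>. F \<pi> + G \<pi>) = perm_avg n F + perm_avg n G"
  by (simp add: perm_avg_def sum.distrib scaleR_add_right)

lemma perm_avg_diff: "perm_avg n (\<lambda>\<pi>. F \<pi> - G \<pi>) = perm_avg n F - perm_avg n G"
  by (simp add: perm_avg_def sum_subtractf scaleR_diff_right)

lemma perm_avg_sum: "perm_avg n (\<lambda>\<pi>. \<Sum>i\<in>I. F i \<pi>) = (\<Sum>i\<in>I. perm_avg n (F i))"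
  unfolding perm_avg_def scaleR_right.sum by (rule sum.swap)

lemma perm_avg_scaleR: "perm_avg n (\<lambda>\<pi>. c *\<^sub>R F \<pi>) = c *\<^sub>R perm_avg n F"
  by (simp add: perm_avg_def flip: scaleR_right.sum)

lemma perm_avg_cmult:
  fixes c :: "'a::real_normed_algebra"
  shows "perm_avg n (\<lambda>\<pi>. c * F \<pi>) = c * perm_avg n F"
  by (simp add: perm_avg_def flip: sum_distrib_left)

lemma perm_avg_const: "perm_avg n (\<lambda>\<pi>. c) = c"
  by (simp add: perm_avg_def sum_constant_scaleR card_perms del: One_nat_def)

lemma perm_avg_mono:
  fixes F G :: "_ \<Rightarrow> real"
  assumes "\<And>\<pi>. \<pi> permutes {1..n} \<Longrightarrow> F \<pi> \<le> G \<pi>"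
  shows "perm_avg n F \<le> perm_avg n G"
  using assms by (auto simp: perm_avg_def intro!: divide_right_mono sum_mono)

lemma norm_perm_avg_le: "norm (perm_avg n F) \<le> perm_avg n (\<lambda>\<pi>. norm (F \<pi>))"
  by (auto simp: perm_avg_def norm_sum intro!: divide_right_mono)

lemma perm_avg_compose_right:
  assumes "\<tau> permutes {1..n}"
  shows "perm_avg n (\<lambda>\<pi>. F (\<pi> \<circ> \<tau>)) = perm_avg n F"
  unfolding perm_avg_def by (subst sum_permutations_compose_right[OF assms, of F]) simp

lemma perm_avg_inv: "perm_avg n (\<lambda>\<pi>. F (inv \<pi>)) = perm_avg n F"
  unfolding perm_avg_def by (subst sum_permutations_inverse[of F]) simp

lemma integral_uniform_perm:
  fixes F :: "(nat \<Rightarrow> nat) \<Rightarrow> 'a::{banach,second_countable_topology}"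
  shows "integrable (uniform_perm n) F" "integral\<^sup>L (uniform_perm n) F = perm_avg n F"
proof -
  have ne: "{\<pi>. \<pi> permutes {1..n}} \<noteq> {}"
    using permutes_id by blast
  have fin: "finite (set_pmf (uniform_perm n))"
    unfolding uniform_perm_def using ne finite_perms by (subst set_pmf_of_set) auto
  then show "integrable (uniform_perm n) F"
    by (rule integrable_measure_pmf_finite)
  have "integral\<^sup>L (uniform_perm n) F =
      (\<Sum>\<pi> | \<pi> permutes {1..n}. pmf (uniform_perm n) \<pi> *\<^sub>R F \<pi>)"
    using ne by (intro integral_measure_pmf finite_perms)
      (auto simp: uniform_perm_def set_pmf_of_set[OF ne finite_perms] simp del: One_nat_def)
  also have "\<dots> = (\<Sum>\<pi> | \<pi> permutes {1..n}. (1 / fact n) *\<^sub>R F \<pi>)"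
    by (intro sum.cong refl)
      (simp add: uniform_perm_def pmf_of_set[OF ne finite_perms] card_perms del: One_nat_def)
  also have "\<dots> = perm_avg n F"
    unfolding scaleR_right.sum[symmetric] by (simp add: perm_avg_def divide_inverse)
  finally show "integral\<^sup>L (uniform_perm n) F = perm_avg n F" .
qed

section \<open>The position of the maximum in a window\<close>

definition top_at :: "(nat \<Rightarrow> nat) \<Rightarrow> nat set \<Rightarrow> nat \<Rightarrow> bool" where
  "top_at \<pi> W p \<longleftrightarrow> (\<forall>q\<in>W. \<pi> q \<le> \<pi> p)"

text \<open>
  The quantities that do not notice how the values on \<open>W\<close> are distributed over its positions;
  transpositions suffice because they generate all rearrangements.
\<close>

definition swap_invariant :: "nat set \<Rightarrow> ((nat \<Rightarrow> nat) \<Rightarrow> 'a) \<Rightarrow> bool" where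
  "swap_invariant W K \<longleftrightarrow> (\<forall>\<pi>. \<forall>p\<in>W. \<forall>q\<in>W. K (\<pi> \<circ> Transposition.transpose p q) = K \<pi>)"

lemma swap_invariantD:
  "swap_invariant W K \<Longrightarrow> p \<in> W \<Longrightarrow> q \<in> W \<Longrightarrow> K (\<pi> \<circ> Transposition.transpose p q) = K \<pi>"
  by (simp add: swap_invariant_def)

lemma swap_invariant_subset: "swap_invariant W K \<Longrightarrow> V \<subseteq> W \<Longrightarrow> swap_invariant V K"
  by (auto simp: swap_invariant_def)

lemma swap_invariant_scaleR:
  "swap_invariant W f \<Longrightarrow> swap_invariant W K \<Longrightarrow> swap_invariant W (\<lambda>\<pi>. f \<pi> *\<^sub>R K \<pi>)"
  by (auto simp: swap_invariant_def)

lemma sum_top_at: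
  assumes "inj \<pi>" "finite W" "W \<noteq> {}"
  shows "(\<Sum>p\<in>W. of_bool (top_at \<pi> W p)) = (1::real)"
proof -
  have "Max (\<pi> ` W) \<in> \<pi> ` W"
    using assms by (intro Max_in) auto
  then obtain m where m: "m \<in> W" "\<pi> m = Max (\<pi> ` W)"
    by auto
  have "top_at \<pi> W p \<longleftrightarrow> p = m" if "p \<in> W" for p
  proof
    assume "top_at \<pi> W p"
    with m that assms have "\<pi> p = \<pi> m"
      by (intro order.antisym) (auto simp: top_at_def)
    with assms(1) show "p = m"
      by (simp add: inj_eq)
  qed (use m assms in \<open>auto simp: top_at_def\<close>)
  then have "(\<Sum>p\<in>W. of_bool (top_at \<pi> W p)) = (\<Sum>p\<in>W. if p = m then 1 else (0::real))"
    by (intro sum.cong) auto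
  with m assms show ?thesis
    by simp
qed

lemma top_at_transpose:
  assumes "p \<in> W" "q \<in> W"
  shows "top_at (\<pi> \<circ> Transposition.transpose p q) W x \<longleftrightarrow> top_at \<pi> W (Transposition.transpose p q x)"
proof -
  have "Transposition.transpose p q ` W = W"
    using permutes_image[OF permutes_swap_id[OF assms]] .
  then have "(\<forall>y\<in>W. \<pi> (Transposition.transpose p q y) \<le> z) \<longleftrightarrow> (\<forall>y\<in>W. \<pi> y \<le> z)" for z
    by (metis (no_types, lifting) imageE imageI)
  then show ?thesis
    by (simp add: top_at_def)
qed

text \<open>
  Moving the maximum from \<open>p\<close> to \<open>q\<close> by the transposition of \<open>p\<close> and \<open>q\<close> preserves the uniform
  distribution. If \<open>K\<close> did not notice these transpositions, all \<open>|W|\<close> positions of the maximum would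
  therefore get the same weight; in general the defect is the change of \<open>K\<close>. The quantitative form is what
  makes room for a factor that depends on the inverse permutation.
\<close>

lemma perm_avg_top_at_approx:
  fixes K :: "_ \<Rightarrow> 'a::real_normed_vector"
  assumes W: "W \<subseteq> {1..n}" and p: "p \<in> W"
  shows "norm (perm_avg n (\<lambda>\<pi>. (of_bool (top_at \<pi> W p) - 1 / card W) *\<^sub>R K \<pi>)) \<le>
    (\<Sum>q\<in>W. perm_avg n (\<lambda>\<pi>. norm (K (\<pi> \<circ> Transposition.transpose p q) - K \<pi>))) / card W"
proof -
  have fW: "finite W"
    using W finite_subset by blast
  have cW: "card W > 0"
    using fW p by (auto simp: card_gt_0_iff)
  let ?I = "\<lambda>\<pi> q. of_bool (top_at \<pi> W q) :: real"
  let ?D = "\<lambda>q \<pi>. K (\<pi> \<circ> Transposition.transpose p q) - K \<pi>"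
  have move: "perm_avg n (\<lambda>\<pi>. ?I \<pi> p *\<^sub>R K \<pi>) = perm_avg n (\<lambda>\<pi>. ?I \<pi> q *\<^sub>R K (\<pi> \<circ> Transposition.transpose p q))"
    if "q \<in> W" for q
  proof -
    have "Transposition.transpose p q permutes {1..n}"
      using W p that by (intro permutes_swap_id) auto
    from perm_avg_compose_right[OF this, of "\<lambda>\<pi>. ?I \<pi> p *\<^sub>R K \<pi>"] show ?thesis
      using p that by (simp add: top_at_transpose)
  qed
  have "card W *\<^sub>R perm_avg n (\<lambda>\<pi>. ?I \<pi> p *\<^sub>R K \<pi>)
      = (\<Sum>q\<in>W. perm_avg n (\<lambda>\<pi>. ?I \<pi> p *\<^sub>R K \<pi>))"
    by (simp only: sum_constant_scaleR)
  also have "\<dots> = (\<Sum>q\<in>W. perm_avg n (\<lambda>\<pi>. ?I \<pi> q *\<^sub>R K (\<pi> \<circ> Transposition.transpose p q)))"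
    by (intro sum.cong refl move)
  also have "\<dots> = perm_avg n (\<lambda>\<pi>. (\<Sum>q\<in>W. ?I \<pi> q) *\<^sub>R K \<pi>) +
      perm_avg n (\<lambda>\<pi>. \<Sum>q\<in>W. ?I \<pi> q *\<^sub>R ?D q \<pi>)"
    by (simp only: perm_avg_sum[symmetric] perm_avg_add[symmetric] scaleR_diff_right
        sum_subtractf scaleR_left.sum) simp
  also have "perm_avg n (\<lambda>\<pi>. (\<Sum>q\<in>W. ?I \<pi> q) *\<^sub>R K \<pi>) = perm_avg n K"
    using p fW by (intro perm_avg_cong) (subst sum_top_at, auto dest: permutes_inj)
  finally have eq: "card W *\<^sub>R perm_avg n (\<lambda>\<pi>. (?I \<pi> p - 1 / card W) *\<^sub>R K \<pi>) =
      perm_avg n (\<lambda>\<pi>. \<Sum>q\<in>W. ?I \<pi> q *\<^sub>R ?D q \<pi>)"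
    using cW by (simp add: scaleR_diff_left perm_avg_diff perm_avg_scaleR scaleR_diff_right o_def)
  have "card W * norm (perm_avg n (\<lambda>\<pi>. (?I \<pi> p - 1 / card W) *\<^sub>R K \<pi>)) =
      norm (perm_avg n (\<lambda>\<pi>. \<Sum>q\<in>W. ?I \<pi> q *\<^sub>R ?D q \<pi>))"
    unfolding eq[symmetric] by simp
  also have "\<dots> \<le> perm_avg n (\<lambda>\<pi>. \<Sum>q\<in>W. norm (?D q \<pi>))"
    by (intro order.trans[OF norm_perm_avg_le] perm_avg_mono sum_norm_le) auto
  also have "\<dots> = (\<Sum>q\<in>W. perm_avg n (\<lambda>\<pi>. norm (?D q \<pi>)))"
    by (rule perm_avg_sum)
  finally show ?thesis
    using cW by (simp add: field_simps)
qed

lemma perm_avg_top_at: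
  fixes K :: "_ \<Rightarrow> 'a::real_normed_vector"
  assumes W: "W \<subseteq> {1..n}" and p: "p \<in> W" and K: "swap_invariant W K"
  shows "perm_avg n (\<lambda>\<pi>. of_bool (top_at \<pi> W p) *\<^sub>R K \<pi>) = (1 / card W) *\<^sub>R perm_avg n K"
proof -
  have "(\<Sum>q\<in>W. perm_avg n (\<lambda>\<pi>. norm (K (\<pi> \<circ> Transposition.transpose p q) - K \<pi>))) = 0"
    using p by (intro sum.neutral ballI) (simp add: swap_invariantD[OF K] perm_avg_const)
  with perm_avg_top_at_approx[OF W p, of K]
  have "perm_avg n (\<lambda>\<pi>. (of_bool (top_at \<pi> W p) - 1 / card W) *\<^sub>R K \<pi>) = 0"
    by simp
  then show ?thesis
    by (simp add: scaleR_diff_left perm_avg_diff perm_avg_scaleR)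
qed

section \<open>First and second moments of the peak indicators\<close>

definition peak_dev :: "nat \<Rightarrow> nat \<Rightarrow> (nat \<Rightarrow> nat) \<Rightarrow> real" where
  "peak_dev n i \<pi> = of_bool (i \<in> peaks n \<pi>) - 1 / 3"

definition peak_sum :: "nat \<Rightarrow> (nat \<Rightarrow> nat) \<Rightarrow> real" where
  "peak_sum n \<pi> = (\<Sum>i\<in>{2..n - 1}. peak_dev n i \<pi>)"

text \<open>
  The covariances of the peak indicators: \<open>2/9 = (1/3)(2/3)\<close> on the diagonal, \<open>-1/9\<close> for neighbours
  because they are never peaks together, and \<open>2/15 - 1/9\<close> at distance two. Beyond that, the windows are
  disjoint and the indicators are independent.
\<close>

definition peak_cov :: "nat \<Rightarrow> nat \<Rightarrow> real" where
  "peak_cov i j = (if i = j then 2 / 9 else if j = i + 1 \<or> i = j + 1 then - 1 / 9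
     else if j = i + 2 \<or> i = j + 2 then 1 / 45 else 0)"

abbreviation window :: "nat \<Rightarrow> nat set" where
  "window i \<equiv> {i - 1, i, i + 1}"

lemma abs_peak_dev_le: "\<bar>peak_dev n i \<pi>\<bar> \<le> 2 / 3"
  by (simp add: peak_dev_def)

lemma peaks_iff_top_at:
  assumes "inj \<pi>" "i \<in> {2..n - 1}"
  shows "i \<in> peaks n \<pi> \<longleftrightarrow> top_at \<pi> (window i) i"
proof -
  have "\<pi> (i - 1) \<noteq> \<pi> i" "\<pi> (i + 1) \<noteq> \<pi> i"
    using assms by (auto simp: inj_eq)
  then show ?thesis
    using assms(2) by (auto simp: peaks_def top_at_def)
qed

lemma card_window: "i \<ge> 2 \<Longrightarrow> card (window i) = 3"
  by (auto simp: card_insert_if)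

lemma swap_invariant_peak_dev:
  assumes "W \<inter> window i = {}"
  shows "swap_invariant W (peak_dev n i)"
proof -
  have "peak_dev n i (\<pi> \<circ> Transposition.transpose p q) = peak_dev n i \<pi>"
    if "p \<in> W" "q \<in> W" for \<pi> p q
  proof -
    have "p \<notin> window i" "q \<notin> window i"
      using assms that by blast+
    then show ?thesis
      by (simp add: peak_dev_def peaks_def transpose_apply_other)
  qed
  then show ?thesis
    by (simp add: swap_invariant_def)
qed

lemma perm_avg_peak_dev_approx:
  fixes K :: "_ \<Rightarrow> 'a::real_normed_vector"
  assumes i: "i \<in> {2..n - 1}"
  shows "norm (perm_avg n (\<lambda>\<pi>. peak_dev n i \<pi> *\<^sub>R K \<pi>)) \<le>
    (\<Sum>q\<in>{i - 1, i + 1}. perm_avg n (\<lambda>\<pi>. norm (K (\<pi> \<circ> Transposition.transpose i q) - K \<pi>))) / 3"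
proof -
  have W: "window i \<subseteq> {1..n}" and c: "card (window i) = 3"
    using i card_window[of i] by auto
  have "perm_avg n (\<lambda>\<pi>. peak_dev n i \<pi> *\<^sub>R K \<pi>) =
      perm_avg n (\<lambda>\<pi>. (of_bool (top_at \<pi> (window i) i) - 1 / card (window i)) *\<^sub>R K \<pi>)"
    using i by (intro perm_avg_cong)
      (simp add: peak_dev_def peaks_iff_top_at[OF permutes_inj] card_window del: One_nat_def)
  also have "norm \<dots> \<le> (\<Sum>q\<in>window i. perm_avg n (\<lambda>\<pi>. norm (K (\<pi> \<circ> Transposition.transpose i q) - K \<pi>))) / card (window i)"
    using W by (intro perm_avg_top_at_approx) auto
  also have "window i = insert i {i - 1, i + 1}"
    by auto
  also have "(\<Sum>q\<in>insert i {i - 1, i + 1}. perm_avg n (\<lambda>\<pi>. norm (K (\<pi> \<circ> Transposition.transpose i q) - K \<pi>)))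
     = (\<Sum>q\<in>{i - 1, i + 1}. perm_avg n (\<lambda>\<pi>. norm (K (\<pi> \<circ> Transposition.transpose i q) - K \<pi>)))"
    using i by (subst sum.insert) (auto simp: perm_avg_const)
  also have "card (insert i {i - 1, i + 1}) = 3"
    using i card_window[of i] by (simp add: insert_commute)
  finally show ?thesis
    by (simp only: of_nat_numeral)
qed

lemma perm_avg_peak_dev:
  fixes K :: "_ \<Rightarrow> 'a::real_normed_vector"
  assumes i: "i \<in> {2..n - 1}" and K: "swap_invariant (window i) K"
  shows "perm_avg n (\<lambda>\<pi>. peak_dev n i \<pi> *\<^sub>R K \<pi>) = 0"
proof -
  have "(\<Sum>q\<in>{i - 1, i + 1}. perm_avg n (\<lambda>\<pi>. norm (K (\<pi> \<circ> Transposition.transpose i q) - K \<pi>))) = 0"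
    by (intro sum.neutral ballI) (auto simp: swap_invariantD[OF K] perm_avg_const)
  with perm_avg_peak_dev_approx[OF i, of K] show ?thesis
    by simp
qed

text \<open>
  If both positions are peaks, then one of them carries the maximum of the five values
  around them (probability \<open>1/5\<close> each), and the other one is the maximum of its own window (probability
  \<open>1/3\<close>, independently, because the maximum of the five stands outside that window). This gives
  \<open>2 \<cdot> 1/5 \<cdot> 1/3 = 2/15\<close>.
\<close>

lemma perm_avg_two_peaks:
  fixes K :: "_ \<Rightarrow> 'a::real_normed_vector"
  assumes i: "i \<in> {2..n - 1}" "i + 2 \<in> {2..n - 1}" and K: "swap_invariant (window i \<union> window (i + 2)) K"
  shows "perm_avg n (\<lambda>\<pi>. of_bool (i \<in> peaks n \<pi> \<and> i + 2 \<in> peaks n \<pi>) *\<^sub>R K \<pi>) = (2 / 15) *\<^sub>R perm_avg n K"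
proof -
  define W where "W = window i \<union> window (i + 2)"
  have W: "W = {i - 1, i, i + 1, i + 2, i + 3}" and cW: "card W = 5" and WI: "W \<subseteq> {1..n}"
    using i by (auto simp: W_def card_insert_if)
  have one: "perm_avg n (\<lambda>\<pi>. of_bool (top_at \<pi> (window k) k) *\<^sub>R of_bool (top_at \<pi> W l) *\<^sub>R K \<pi>)
      = (1 / 15) *\<^sub>R perm_avg n K"
    if kl: "k \<in> {2..n - 1}" "window k \<subseteq> W" "l \<in> W" "l \<notin> window k" for k l
  proof -
    have top: "swap_invariant (window k) (\<lambda>\<pi>. of_bool (top_at \<pi> W l) :: real)"
      unfolding swap_invariant_def
    proof (intro allI ballI)
      fix \<pi> p q assume pq: "p \<in> window k" "q \<in> window k"
      then have "Transposition.transpose p q l = l"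
        using kl by (intro transpose_apply_other) auto
      moreover have "p \<in> W" "q \<in> W"
        using kl pq by auto
      ultimately show "of_bool (top_at (\<pi> \<circ> Transposition.transpose p q) W l) = (of_bool (top_at \<pi> W l) :: real)"
        by (simp add: top_at_transpose)
    qed
    have "window k \<subseteq> {1..n}"
      using kl by auto
    then have "perm_avg n (\<lambda>\<pi>. of_bool (top_at \<pi> (window k) k) *\<^sub>R of_bool (top_at \<pi> W l) *\<^sub>R K \<pi>)
        = (1 / card (window k)) *\<^sub>R perm_avg n (\<lambda>\<pi>. of_bool (top_at \<pi> W l) *\<^sub>R K \<pi>)"
      by (rule perm_avg_top_at)
        (simp, rule swap_invariant_scaleR[OF top swap_invariant_subset[OF K[folded W_def] kl(2)]])
    also have "card (window k) = 3"
      using kl by (intro card_window) simp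
    also have "perm_avg n (\<lambda>\<pi>. of_bool (top_at \<pi> W l) *\<^sub>R K \<pi>) = (1 / 5) *\<^sub>R perm_avg n K"
      using perm_avg_top_at[OF WI kl(3) K[folded W_def]] by (simp only: cW of_nat_numeral)
    finally show ?thesis
      by simp
  qed
  \<comment> \<open>The two cases are exclusive since the maximum of the five values is attained only once.\<close>
  have split: "of_bool (i \<in> peaks n \<pi> \<and> i + 2 \<in> peaks n \<pi>) =
      of_bool (top_at \<pi> (window (i + 2)) (i + 2)) * of_bool (top_at \<pi> W i) +
      of_bool (top_at \<pi> (window i) i) * (of_bool (top_at \<pi> W (i + 2)) :: real)"
    if "\<pi> permutes {1..n}" for \<pi>
  proof -
    have inj: "inj \<pi>"
      using that by (rule permutes_inj)
    have "\<pi> i \<noteq> \<pi> (i + 2)"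
      using inj by (simp add: inj_eq)
    then have "(top_at \<pi> (window i) i \<and> top_at \<pi> (window (i + 2)) (i + 2)) \<longleftrightarrow>
        top_at \<pi> (window (i + 2)) (i + 2) \<and> top_at \<pi> W i \<or> top_at \<pi> (window i) i \<and> top_at \<pi> W (i + 2)"
      "\<not> (top_at \<pi> W i \<and> top_at \<pi> W (i + 2))"
      by (auto simp: top_at_def W numeral_3_eq_3)
    then show ?thesis
      unfolding peaks_iff_top_at[OF inj i(1)] peaks_iff_top_at[OF inj i(2)] by auto
  qed
  have "perm_avg n (\<lambda>\<pi>. of_bool (i \<in> peaks n \<pi> \<and> i + 2 \<in> peaks n \<pi>) *\<^sub>R K \<pi>) =
     perm_avg n (\<lambda>\<pi>. of_bool (top_at \<pi> (window (i + 2)) (i + 2)) *\<^sub>R of_bool (top_at \<pi> W i) *\<^sub>R K \<pi>) +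
     perm_avg n (\<lambda>\<pi>. of_bool (top_at \<pi> (window i) i) *\<^sub>R of_bool (top_at \<pi> W (i + 2)) *\<^sub>R K \<pi>)"
    unfolding perm_avg_add[symmetric] by (intro perm_avg_cong) (simp only: split scaleR_add_left scaleR_scaleR)
  also have "\<dots> = (1 / 15) *\<^sub>R perm_avg n K + (1 / 15) *\<^sub>R perm_avg n K"
    using i by (intro arg_cong2[where f = "(+)"] one) (auto simp: W)
  also have "\<dots> = (2 / 15) *\<^sub>R perm_avg n K"
    unfolding scaleR_add_left[symmetric] by simp
  finally show ?thesis .
qed

text \<open>
  Single deviations average to zero, and up to multiples of them the product is a constant at
  distance at most one, while at distance two the probability of two simultaneous peaks enters. Farther
  apart, the second deviation is itself invariant on the window of the first.
\<close>

lemma perm_avg_peak_dev_pair: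
  fixes K :: "_ \<Rightarrow> 'a::real_normed_vector"
  assumes "i \<in> {2..n - 1}" "j \<in> {2..n - 1}" "swap_invariant (window i \<union> window j) K"
  shows "perm_avg n (\<lambda>\<pi>. (peak_dev n i \<pi> * peak_dev n j \<pi>) *\<^sub>R K \<pi>) = peak_cov i j *\<^sub>R perm_avg n K"
  using assms
proof (induction i j rule: linorder_wlog)
  case (sym i j)
  then show ?case
    by (simp add: mult.commute peak_cov_def Un_commute disj_commute eq_commute[of i j])
next
  case (le i j)
  have Ki: "swap_invariant (window i) K" and Kj: "swap_invariant (window j) K"
    using le swap_invariant_subset by blast+
  note zero = perm_avg_peak_dev[OF le(2) Ki] perm_avg_peak_dev[OF le(3) Kj]
  consider "j = i" | "j = i + 1" | "j = i + 2" | "j \<ge> i + 3"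
    using le(1) by linarith
  then show ?case
  proof cases
    case 1
    have "(peak_dev n i \<pi> * peak_dev n i \<pi>) *\<^sub>R K \<pi> =
        (1 / 3) *\<^sub>R (peak_dev n i \<pi> *\<^sub>R K \<pi>) + (2 / 9) *\<^sub>R K \<pi>" for \<pi>
      unfolding scaleR_scaleR scaleR_add_left[symmetric] by (simp add: peak_dev_def)
    then show ?thesis
      using 1 zero by (simp only: perm_avg_add perm_avg_scaleR) (simp add: peak_cov_def)
  next
    case 2
    have "(peak_dev n i \<pi> * peak_dev n (i + 1) \<pi>) *\<^sub>R K \<pi> = (- 1 / 3) *\<^sub>R (peak_dev n i \<pi> *\<^sub>R K \<pi>) +
        (- 1 / 3) *\<^sub>R (peak_dev n (i + 1) \<pi> *\<^sub>R K \<pi>) + (- 1 / 9) *\<^sub>R K \<pi>" for \<pi>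
      unfolding scaleR_scaleR scaleR_add_left[symmetric]
      by (rule arg_cong[where f = "\<lambda>c. c *\<^sub>R K \<pi>"]) (auto simp: peak_dev_def peaks_def)
    then show ?thesis
      using 2 zero by (simp only: perm_avg_add perm_avg_scaleR) (simp add: peak_cov_def)
  next
    case 3
    have "(peak_dev n i \<pi> * peak_dev n (i + 2) \<pi>) *\<^sub>R K \<pi> =
        of_bool (i \<in> peaks n \<pi> \<and> i + 2 \<in> peaks n \<pi>) *\<^sub>R K \<pi> + (- 1 / 3) *\<^sub>R (peak_dev n i \<pi> *\<^sub>R K \<pi>) +
        (- 1 / 3) *\<^sub>R (peak_dev n (i + 2) \<pi> *\<^sub>R K \<pi>) + (- 1 / 9) *\<^sub>R K \<pi>" for \<pi>
      unfolding scaleR_scaleR scaleR_add_left[symmetric]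
      by (rule arg_cong[where f = "\<lambda>c. c *\<^sub>R K \<pi>"]) (auto simp: peak_dev_def)
    moreover have "perm_avg n (\<lambda>\<pi>. of_bool (i \<in> peaks n \<pi> \<and> i + 2 \<in> peaks n \<pi>) *\<^sub>R K \<pi>) = (2 / 15) *\<^sub>R perm_avg n K"
      using le 3 by (intro perm_avg_two_peaks) auto
    ultimately have "perm_avg n (\<lambda>\<pi>. (peak_dev n i \<pi> * peak_dev n j \<pi>) *\<^sub>R K \<pi>) =
        (2 / 15) *\<^sub>R perm_avg n K + (- 1 / 9) *\<^sub>R perm_avg n K"
      using 3 zero by (simp only: perm_avg_add perm_avg_scaleR) simp
    also have "\<dots> = peak_cov i j *\<^sub>R perm_avg n K"
      unfolding scaleR_add_left[symmetric] using 3 by (simp add: peak_cov_def)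
    finally show ?thesis .
  next
    case 4
    have "window i \<inter> window j = {}"
      using le 4 by auto
    then have "swap_invariant (window i) (\<lambda>\<pi>. peak_dev n j \<pi> *\<^sub>R K \<pi>)"
      by (intro swap_invariant_scaleR swap_invariant_peak_dev Ki)
    from perm_avg_peak_dev[OF le(2) this] show ?thesis
      using 4 by (simp add: peak_cov_def)
  qed
qed

text \<open>
  Each new position adds \<open>2/9 + 2(-1/9 + 1/45) = 2/45\<close>, which explains the variance in the theorem. The
  formula starts at \<open>n = 4\<close>: before that, a new position does not have two predecessors.
\<close>

lemma sum_peak_cov:
  assumes "n \<ge> 4"
  shows "(\<Sum>i\<in>{2..n - 1}. \<Sum>j\<in>{2..n - 1}. peak_cov i j) = 2 * (real n + 1) / 45"
  using assms
proof (induction n rule: dec_induct)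
  case base
  have "{2..4 - 1} = {2, 3::nat}"
    by auto
  then show ?case
    by (simp add: peak_cov_def)
next
  case (step n)
  let ?I = "{2..n - 1}"
  have I: "{2..Suc n - 1} = insert n ?I" "n \<notin> ?I"
    using step by auto
  have row: "(\<Sum>j\<in>?I. peak_cov n j) = - 4 / 45"
  proof -
    have "(\<Sum>j\<in>?I. peak_cov n j) = (\<Sum>j\<in>{n - 2, n - 1}. peak_cov n j)"
      using step by (intro sum.mono_neutral_right) (auto simp: peak_cov_def)
    also have "\<dots> = - 4 / 45"
    proof -
      obtain m where "n = m + 4"
        using step.hyps(1) le_Suc_ex by (metis add.commute)
      then show ?thesis
        by (simp add: peak_cov_def)
    qed
    finally show ?thesis .
  qed
  have col: "(\<Sum>i\<in>?I. peak_cov i n) = - 4 / 45"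
    using row by (simp add: peak_cov_def eq_commute disj_commute cong: if_cong)
  have "(\<Sum>i\<in>insert n ?I. \<Sum>j\<in>insert n ?I. peak_cov i j) =
      peak_cov n n + (\<Sum>j\<in>?I. peak_cov n j) + (\<Sum>i\<in>?I. peak_cov i n) + (\<Sum>i\<in>?I. \<Sum>j\<in>?I. peak_cov i j)"
    using I by (simp add: sum.distrib)
  also have "\<dots> = 2 * (real (Suc n) + 1) / 45"
    unfolding row col step.IH by (simp add: peak_cov_def)
  finally show ?case
    unfolding I(1) .
qed

lemma perm_avg_peak_sum_sq:
  assumes "n \<ge> 4"
  shows "perm_avg n (\<lambda>\<pi>. (peak_sum n \<pi>)\<^sup>2) = 2 * (real n + 1) / 45"
proof -
  have "perm_avg n (\<lambda>\<pi>. (peak_sum n \<pi>)\<^sup>2) =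
      (\<Sum>i\<in>{2..n - 1}. \<Sum>j\<in>{2..n - 1}. perm_avg n (\<lambda>\<pi>. (peak_dev n i \<pi> * peak_dev n j \<pi>) *\<^sub>R 1))"
    by (simp add: peak_sum_def power2_eq_square sum_product perm_avg_sum)
  also have "\<dots> = (\<Sum>i\<in>{2..n - 1}. \<Sum>j\<in>{2..n - 1}. peak_cov i j)"
    by (intro sum.cong refl, subst perm_avg_peak_dev_pair) (auto simp: perm_avg_const swap_invariant_def)
  finally show ?thesis
    by (simp only: sum_peak_cov[OF assms])
qed

section \<open>Concentration of the quadratic local term\<close>

text \<open>
  The pairs of positions at distance at most two are those with overlapping windows, hence those
  with dependent peak indicators. Summing the products of deviations over them gives \<open>\<Sum> a\<^sub>i A\<^sub>i\<close> in
  the notation of the introduction.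
\<close>

definition close_pairs :: "nat \<Rightarrow> (nat \<times> nat) set" where
  "close_pairs n = {(i, j). i \<in> {2..n - 1} \<and> j \<in> {2..n - 1} \<and> i \<le> j + 2 \<and> j \<le> i + 2}"

definition close_prod_sum :: "nat \<Rightarrow> (nat \<Rightarrow> nat) \<Rightarrow> real" where
  "close_prod_sum n \<pi> = (\<Sum>(i, j)\<in>close_pairs n. peak_dev n i \<pi> * peak_dev n j \<pi>)"

lemma close_pairs_subset: "close_pairs n \<subseteq> {2..n - 1} \<times> {2..n - 1}"
  by (auto simp: close_pairs_def)

lemma finite_close_pairs: "finite (close_pairs n)"
  using close_pairs_subset by (rule finite_subset) simp

lemma card_sigma_near_le:
  assumes "finite A"
  shows "card (SIGMA k:A. {k - 2..k + 2 :: nat}) \<le> 5 * card A"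
proof -
  have "card (SIGMA k:A. {k - 2..k + 2 :: nat}) = (\<Sum>k\<in>A. card {k - 2..k + 2})"
    using assms by (simp add: card_SigmaI)
  also have "\<dots> \<le> (\<Sum>k\<in>A. 5)"
    by (intro sum_mono) auto
  finally show ?thesis
    by simp
qed

lemma card_close_pairs_le: "card (close_pairs n) \<le> 5 * n"
proof -
  have "card (close_pairs n) \<le> card (SIGMA k:{2..n - 1}. {k - 2..k + 2})"
    by (intro card_mono finite_SigmaI) (auto simp: close_pairs_def)
  also have "\<dots> \<le> 5 * card {2..n - 1}"
    by (intro card_sigma_near_le) simp
  also have "\<dots> \<le> 5 * n"
    by simp
  finally show ?thesis .
qed

lemma sum_close_pairs_peak_cov:
  assumes "n \<ge> 4"
  shows "(\<Sum>(i, j)\<in>close_pairs n. peak_cov i j) = 2 * (real n + 1) / 45"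
proof -
  have "(\<Sum>(i, j)\<in>close_pairs n. peak_cov i j) = (\<Sum>(i, j)\<in>{2..n - 1} \<times> {2..n - 1}. peak_cov i j)"
    by (intro sum.mono_neutral_left close_pairs_subset)
      (auto simp: close_pairs_def peak_cov_def split: if_splits)
  then show ?thesis
    by (simp only: sum.cartesian_product[symmetric] sum_peak_cov[OF assms])
qed

text \<open>
  The sum has \<open>O(n)\<close> bounded centred terms, and each term is uncorrelated with all but boundedly many
  others: the windows of two close pairs whose first entries differ by at least seven are disjoint.
\<close>

lemma perm_avg_close_prod_sum_deviation_sq:
  assumes "n \<ge> 4"
  shows "perm_avg n (\<lambda>\<pi>. (close_prod_sum n \<pi> - 2 * (real n + 1) / 45)\<^sup>2) \<le> 325 * real n"
proof -
  define z :: "nat \<times> nat \<Rightarrow> (nat \<Rightarrow> nat) \<Rightarrow> real" where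
    "z d \<pi> = peak_dev n (fst d) \<pi> * peak_dev n (snd d) \<pi> - peak_cov (fst d) (snd d)" for d \<pi>
  define near :: "nat \<times> nat \<Rightarrow> nat \<times> nat \<Rightarrow> bool" where
    "near d e \<longleftrightarrow> fst e < fst d + 7 \<and> fst d < fst e + 7" for d e
  have z_le: "\<bar>z d \<pi>\<bar> \<le> 1" for d \<pi>
  proof -
    have "\<bar>peak_dev n (fst d) \<pi> * peak_dev n (snd d) \<pi>\<bar> \<le> (2 / 3) * (2 / 3)"
      unfolding abs_mult by (intro mult_mono abs_peak_dev_le) auto
    moreover have "\<bar>peak_cov (fst d) (snd d)\<bar> \<le> 2 / 9"
      by (simp add: peak_cov_def)
    ultimately show ?thesis
      unfolding z_def by linarith
  qed
  have far: "perm_avg n (\<lambda>\<pi>. z d \<pi> * z e \<pi>) = 0"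
    if de: "d \<in> close_pairs n" "e \<in> close_pairs n" "\<not> near d e" for d e
  proof -
    obtain i j k l where [simp]: "d = (i, j)" "e = (k, l)"
      by (cases d, cases e)
    have "(window i \<union> window j) \<inter> (window k \<union> window l) = {}"
      using de by (auto simp: close_pairs_def near_def)
    then have "swap_invariant (window i \<union> window j) (peak_dev n k)"
      "swap_invariant (window i \<union> window j) (peak_dev n l)"
      by (intro swap_invariant_peak_dev; blast)+
    then have inv: "swap_invariant (window i \<union> window j) (z e)"
      unfolding swap_invariant_def z_def by (metis fst_conv snd_conv \<open>e = (k, l)\<close>)
    have "z d \<pi> * z e \<pi> = (peak_dev n i \<pi> * peak_dev n j \<pi>) *\<^sub>R z e \<pi> - peak_cov i j * z e \<pi>" for \<pi>
      unfolding z_def by (simp add: algebra_simps)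
    then have "perm_avg n (\<lambda>\<pi>. z d \<pi> * z e \<pi>) =
        perm_avg n (\<lambda>\<pi>. (peak_dev n i \<pi> * peak_dev n j \<pi>) *\<^sub>R z e \<pi>) - peak_cov i j * perm_avg n (z e)"
      by (simp only: perm_avg_diff perm_avg_cmult)
    also have "\<dots> = 0"
      using de by (subst perm_avg_peak_dev_pair[OF _ _ inv]) (auto simp: close_pairs_def)
    finally show ?thesis .
  qed
  have near_card: "card {e \<in> close_pairs n. near d e} \<le> 65" for d
  proof -
    have "{e \<in> close_pairs n. near d e} \<subseteq> (SIGMA k:{fst d - 6..fst d + 6}. {k - 2..k + 2})"
      by (auto simp: close_pairs_def near_def)
    then have "card {e \<in> close_pairs n. near d e} \<le> card (SIGMA k:{fst d - 6..fst d + 6}. {k - 2..k + 2})"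
      by (intro card_mono finite_SigmaI) auto
    also have "\<dots> \<le> 5 * card {fst d - 6..fst d + 6}"
      by (intro card_sigma_near_le) simp
    finally show ?thesis
      by simp
  qed
  have "close_prod_sum n \<pi> - 2 * (real n + 1) / 45 = (\<Sum>d\<in>close_pairs n. z d \<pi>)" for \<pi>
    unfolding sum_close_pairs_peak_cov[OF assms, symmetric]
    by (simp add: close_prod_sum_def z_def sum_subtractf case_prod_unfold)
  then have "perm_avg n (\<lambda>\<pi>. (close_prod_sum n \<pi> - 2 * (real n + 1) / 45)\<^sup>2) =
      (\<Sum>d\<in>close_pairs n. \<Sum>e\<in>close_pairs n. perm_avg n (\<lambda>\<pi>. z d \<pi> * z e \<pi>))"
    by (simp only: power2_eq_square sum_product perm_avg_sum)
  also have "\<dots> = (\<Sum>d\<in>close_pairs n. \<Sum>e\<in>{e \<in> close_pairs n. near d e}. perm_avg n (\<lambda>\<pi>. z d \<pi> * z e \<pi>))"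
    using far by (intro sum.cong refl sum.mono_neutral_right finite_close_pairs) auto
  also have "\<dots> \<le> (\<Sum>d\<in>close_pairs n. \<Sum>e\<in>{e \<in> close_pairs n. near d e}. perm_avg n (\<lambda>\<pi>. 1))"
  proof (intro sum_mono perm_avg_mono)
    fix d e \<pi>
    have "\<bar>z d \<pi>\<bar> * \<bar>z e \<pi>\<bar> \<le> 1 * 1"
      by (intro mult_mono z_le) auto
    then show "z d \<pi> * z e \<pi> \<le> 1"
      using abs_ge_self[of "z d \<pi> * z e \<pi>"] by (simp add: abs_mult)
  qed
  also have "\<dots> \<le> (\<Sum>d\<in>close_pairs n. 65)"
    using near_card by (intro sum_mono[of "close_pairs n"]) (simp add: perm_avg_const)
  also have "\<dots> \<le> 325 * real n"
    using card_close_pairs_le[of n] by simp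
  finally show ?thesis .
qed

lemma perm_avg_close_prod_sum_deviation:
  assumes "n \<ge> 4"
  shows "perm_avg n (\<lambda>\<pi>. \<bar>close_prod_sum n \<pi> - 2 * (real n + 1) / 45\<bar>) \<le> 163 * sqrt n"
proof -
  let ?x = "\<lambda>\<pi>. close_prod_sum n \<pi> - 2 * (real n + 1) / 45"
  have sn: "sqrt n > 0"
    using assms by simp
  \<comment> \<open>AM-GM, balanced at the typical size \<open>\<surd>n\<close> of the deviation\<close>
  have "perm_avg n (\<lambda>\<pi>. \<bar>?x \<pi>\<bar>) \<le> perm_avg n (\<lambda>\<pi>. (1 / (2 * sqrt n)) * (?x \<pi>)\<^sup>2 + sqrt n / 2)"
  proof (rule perm_avg_mono)
    fix \<pi>
    have "0 \<le> (\<bar>?x \<pi>\<bar> - sqrt n)\<^sup>2"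
      by simp
    then have "2 * sqrt n * \<bar>?x \<pi>\<bar> \<le> (?x \<pi>)\<^sup>2 + sqrt n * sqrt n"
      by (simp add: power2_diff power2_eq_square algebra_simps del: real_sqrt_mult_self)
    then show "\<bar>?x \<pi>\<bar> \<le> (1 / (2 * sqrt n)) * (?x \<pi>)\<^sup>2 + sqrt n / 2"
      using sn by (simp add: field_simps del: real_sqrt_mult_self)
  qed
  also have "\<dots> = (1 / (2 * sqrt n)) * perm_avg n (\<lambda>\<pi>. (?x \<pi>)\<^sup>2) + sqrt n / 2"
    by (simp only: perm_avg_add perm_avg_cmult perm_avg_const)
  also have "\<dots> \<le> (1 / (2 * sqrt n)) * (325 * real n) + sqrt n / 2"
    using sn by (intro add_right_mono mult_left_mono perm_avg_close_prod_sum_deviation_sq assms) auto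
  also have "(1 / (2 * sqrt n)) * (325 * real n) + sqrt n / 2 = 325 / 2 * (real n / sqrt n) + sqrt n / 2"
    by simp
  also have "\<dots> = 163 * sqrt n"
    by (subst real_div_sqrt) auto
  finally show ?thesis .
qed

section \<open>The approximate Stein equation\<close>

text \<open>
  For \<open>g = 1\<close> this is the characteristic function of \<open>S\<close>. The weight \<open>g\<close> will be
  \<open>exp(\<i> t Y)\<close>, which depends on \<open>\<pi>\<close> through the peaks of its inverse.
\<close>

definition peak_cf :: "nat \<Rightarrow> ((nat \<Rightarrow> nat) \<Rightarrow> complex) \<Rightarrow> real \<Rightarrow> complex" where
  "peak_cf n g r = perm_avg n (\<lambda>\<pi>. iexp (r * peak_sum n \<pi>) * g \<pi>)"

lemma iexp_add: "iexp (x + y) = iexp x * iexp y"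
  by (simp add: distrib_left exp_add)

lemma norm_iexp_diff_le: "norm (iexp x - iexp y) \<le> \<bar>x - y\<bar>"
proof -
  have "iexp x - iexp y = iexp y * (iexp (x - y) - 1)"
    by (simp add: algebra_simps flip: exp_add)
  then have "norm (iexp x - iexp y) = norm (iexp (x - y) - 1)"
    by (simp add: norm_mult)
  also have "\<dots> \<le> \<bar>x - y\<bar>"
    using iexp_approx1[of "x - y" 0] by simp
  finally show ?thesis .
qed

lemma norm_iexp_linear_le: "norm (iexp x - 1 - \<i> * x) \<le> x\<^sup>2 / 2"
  using iexp_approx1[of x 1] by (simp add: power2_eq_square algebra_simps)

lemma peak_cf_has_vector_derivative:
  "(peak_cf n g has_vector_derivative
    perm_avg n (\<lambda>\<pi>. \<i> * peak_sum n \<pi> * iexp (r * peak_sum n \<pi>) * g \<pi>)) (at r within S)"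
proof -
  have "((\<lambda>r. iexp (r * x) * c) has_vector_derivative \<i> * x * iexp (r * x) * c) (at r within S)"
    for x :: real and c
  proof -
    have "((iexp \<circ> (\<lambda>r. r * x)) has_vector_derivative x *\<^sub>R (\<i> * iexp (r * x))) (at r within S)"
      by (intro vector_diff_chain_within has_vector_derivative_iexp) (auto intro!: derivative_eq_intros)
    from has_vector_derivative_mult_left[OF this, of c] show ?thesis
      by (simp add: o_def scaleR_conv_of_real algebra_simps)
  qed
  then show ?thesis
    unfolding peak_cf_def perm_avg_def
    by (intro bounded_linear.has_vector_derivative[OF bounded_linear_scaleR_right]
        has_vector_derivative_sum)
qed

text \<open>
  The local expansion of Stein's method. With \<open>a\<^sub>i\<close> and \<open>A\<^sub>i\<close> as in the introduction,
  \<open>a\<^sub>i exp(\<i> r S)\<close> splits into \<open>a\<^sub>i exp(\<i> r (S - A\<^sub>i))\<close>, whose average against \<open>g\<close> is small because the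
  second factor ignores the window of \<open>i\<close> and \<open>g\<close> nearly does; the term \<open>\<i> r a\<^sub>i A\<^sub>i exp(\<i> r S)\<close>,
  whose sum over \<open>i\<close> is close to \<open>\<i> r \<sigma>\<^sup>2 exp(\<i> r S)\<close> by concentration; and a remainder of order \<open>r\<^sup>2\<close>.
  The three parts give the three terms of the bound.
\<close>

lemma peak_cf_stein_bound:
  assumes n: "n \<ge> 4"
    and g: "\<And>\<pi>. norm (g \<pi>) \<le> 1"
    and \<delta>: "\<And>i q. i \<in> {2..n - 1} \<Longrightarrow> q \<in> {i - 1, i + 1} \<Longrightarrow>
      perm_avg n (\<lambda>\<pi>. norm (g (\<pi> \<circ> Transposition.transpose i q) - g \<pi>)) \<le> \<delta>"
  shows "norm (perm_avg n (\<lambda>\<pi>. \<i> * peak_sum n \<pi> * iexp (r * peak_sum n \<pi>) * g \<pi>)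
      + (2 * (real n + 1) / 45 * r) * peak_cf n g r)
    \<le> n * \<delta> + 13 * n * r\<^sup>2 + 163 * sqrt n * \<bar>r\<bar>"
proof -
  define I where "I = {2..n - 1}"
  define near where "near i = {j \<in> I. i \<le> j + 2 \<and> j \<le> i + 2}" for i
  define A where "A i \<pi> = (\<Sum>j\<in>near i. peak_dev n j \<pi>)" for i \<pi>
  define B where "B i \<pi> = (\<Sum>j\<in>I - near i. peak_dev n j \<pi>)" for i \<pi>
  \<comment> \<open>\<open>\<rho> i \<pi> * exp (\<i> r S)\<close> is the error of the first-order expansion of \<open>exp (\<i> r S)\<close> around
      \<open>exp (\<i> r B)\<close>; basing it at \<open>exp (\<i> r S)\<close> makes the linear term a multiple of \<open>exp (\<i> r S)\<close>.\<close>
  define \<rho> where "\<rho> i \<pi> = 1 - \<i> * (r * A i \<pi>) - iexp (- (r * A i \<pi>))" for i \<pi>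
  define v where "v = 2 * (real n + 1) / 45"
  define e where "e \<pi> = iexp (r * peak_sum n \<pi>)" for \<pi>
  define K where "K i \<pi> = iexp (r * B i \<pi>) * g \<pi>" for i \<pi>
  have finI: "finite I"
    by (simp add: I_def)
  have near_I: "near i \<subseteq> I" for i
    by (auto simp: near_def)
  have split: "peak_sum n \<pi> = A i \<pi> + B i \<pi>" for i \<pi>
    unfolding peak_sum_def A_def B_def I_def[symmetric]
    using sum.subset_diff[OF near_I finI] by (simp add: add.commute)
  have norm_e: "norm (e \<pi>) = 1" for \<pi>
    by (simp add: e_def)

  have near_card: "card (near i) \<le> 5" for i
  proof -
    have "card (near i) \<le> card {i - 2..i + 2}"
      by (intro card_mono) (auto simp: near_def)
    then show ?thesis
      by simp
  qed
  have A_le: "\<bar>A i \<pi>\<bar> \<le> 5" for i \<pi>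
  proof -
    have "\<bar>A i \<pi>\<bar> \<le> (\<Sum>j\<in>near i. \<bar>peak_dev n j \<pi>\<bar>)"
      unfolding A_def by (rule sum_abs)
    also have "\<dots> \<le> (\<Sum>j\<in>near i. 1)"
      by (intro sum_mono order.trans[OF abs_peak_dev_le]) simp
    also have "\<dots> \<le> 5"
      using near_card[of i] by simp
    finally show ?thesis .
  qed
  have \<rho>_le: "norm (\<rho> i \<pi>) \<le> 13 * r\<^sup>2" for i \<pi>
  proof -
    have "norm (\<rho> i \<pi>) = norm (iexp (- (r * A i \<pi>)) - 1 - \<i> * (- (r * A i \<pi>)))"
      unfolding \<rho>_def by (subst norm_minus_cancel[symmetric]) (simp add: algebra_simps)
    also have "\<dots> \<le> (- (r * A i \<pi>))\<^sup>2 / 2"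
      by (rule norm_iexp_linear_le)
    also have "\<dots> = r\<^sup>2 * \<bar>A i \<pi>\<bar>\<^sup>2 / 2"
      by (simp add: power_mult_distrib)
    also have "\<dots> \<le> r\<^sup>2 * 5\<^sup>2 / 2"
      by (intro divide_right_mono mult_left_mono power_mono A_le) auto
    also have "\<dots> \<le> 13 * r\<^sup>2"
      by simp
    finally show ?thesis .
  qed
  have prod_sum: "close_prod_sum n \<pi> = (\<Sum>i\<in>I. peak_dev n i \<pi> * A i \<pi>)" for \<pi>
  proof -
    have "close_pairs n = (SIGMA i:I. near i)"
      by (auto simp: close_pairs_def I_def near_def)
    then show ?thesis
      unfolding close_prod_sum_def A_def sum_distrib_left
      by (simp add: sum.Sigma finI near_def)
  qed

  have pointwise: "\<i> * peak_sum n \<pi> * e \<pi> * g \<pi> + (v * r) * (e \<pi> * g \<pi>) =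
      \<i> * (\<Sum>i\<in>I. peak_dev n i \<pi> *\<^sub>R K i \<pi>)
      + ((v - close_prod_sum n \<pi>) * r) * (e \<pi> * g \<pi>)
      + \<i> * (\<Sum>i\<in>I. peak_dev n i \<pi> *\<^sub>R (\<rho> i \<pi> * (e \<pi> * g \<pi>)))" for \<pi>
  proof -
    have term_eq: "peak_dev n i \<pi> *\<^sub>R (e \<pi> * g \<pi>) = peak_dev n i \<pi> *\<^sub>R K i \<pi>
        + (\<i> * r * (peak_dev n i \<pi> * A i \<pi>)) * (e \<pi> * g \<pi>)
        + peak_dev n i \<pi> *\<^sub>R (\<rho> i \<pi> * (e \<pi> * g \<pi>))" for i
    proof -
      have "iexp (r * B i \<pi>) = iexp (r * peak_sum n \<pi> + - (r * A i \<pi>))"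
        by (simp add: split[of \<pi> i] algebra_simps)
      then have "K i \<pi> = e \<pi> * iexp (- (r * A i \<pi>)) * g \<pi>"
        unfolding K_def e_def iexp_add by simp
      then have "e \<pi> * g \<pi> = K i \<pi> + \<i> * (r * A i \<pi>) * (e \<pi> * g \<pi>) + \<rho> i \<pi> * (e \<pi> * g \<pi>)"
        unfolding \<rho>_def by (simp add: algebra_simps)
      then have "peak_dev n i \<pi> *\<^sub>R (e \<pi> * g \<pi>) =
          peak_dev n i \<pi> *\<^sub>R (K i \<pi> + \<i> * (r * A i \<pi>) * (e \<pi> * g \<pi>) + \<rho> i \<pi> * (e \<pi> * g \<pi>))"
        by (rule arg_cong)
      also have "\<dots> = peak_dev n i \<pi> *\<^sub>R K i \<pi>
        + (\<i> * r * (peak_dev n i \<pi> * A i \<pi>)) * (e \<pi> * g \<pi>)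
        + peak_dev n i \<pi> *\<^sub>R (\<rho> i \<pi> * (e \<pi> * g \<pi>))"
        by (simp add: scaleR_conv_of_real algebra_simps)
      finally show ?thesis .
    qed
    have "\<i> * peak_sum n \<pi> * e \<pi> * g \<pi> = \<i> * (\<Sum>i\<in>I. peak_dev n i \<pi> *\<^sub>R (e \<pi> * g \<pi>))"
      unfolding peak_sum_def I_def[symmetric] scaleR_left.sum[symmetric]
      by (simp add: scaleR_conv_of_real mult_ac)
    also have "\<dots> = \<i> * (\<Sum>i\<in>I. peak_dev n i \<pi> *\<^sub>R K i \<pi>)
        + \<i> * ((\<i> * r * close_prod_sum n \<pi>) * (e \<pi> * g \<pi>))
        + \<i> * (\<Sum>i\<in>I. peak_dev n i \<pi> *\<^sub>R (\<rho> i \<pi> * (e \<pi> * g \<pi>)))"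
      unfolding term_eq sum.distrib prod_sum
      by (simp add: distrib_left sum_distrib_left sum_distrib_right)
    finally show ?thesis
      by (simp add: algebra_simps)
  qed

  have main: "norm (perm_avg n (\<lambda>\<pi>. peak_dev n i \<pi> *\<^sub>R K i \<pi>)) \<le> \<delta>" if i: "i \<in> I" for i
  proof -
    have "(\<Sum>q\<in>{i - 1, i + 1}. perm_avg n (\<lambda>\<pi>. norm (K i (\<pi> \<circ> Transposition.transpose i q) - K i \<pi>)))
        \<le> (\<Sum>q\<in>{i - 1, i + 1}. \<delta>)"
    proof (rule sum_mono)
      fix q assume q: "q \<in> {i - 1, i + 1}"
      have "swap_invariant (window i) (peak_dev n j)" if "j \<in> I - near i" for j
        using that by (intro swap_invariant_peak_dev) (auto simp: near_def)
      then have "B i (\<pi> \<circ> Transposition.transpose i q) = B i \<pi>" for \<pi>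
        unfolding B_def using q by (intro sum.cong refl swap_invariantD[of "window i"]) auto
      then have "norm (K i (\<pi> \<circ> Transposition.transpose i q) - K i \<pi>) =
          norm (g (\<pi> \<circ> Transposition.transpose i q) - g \<pi>)" for \<pi>
        unfolding K_def by (simp add: norm_mult flip: right_diff_distrib)
      then show "perm_avg n (\<lambda>\<pi>. norm (K i (\<pi> \<circ> Transposition.transpose i q) - K i \<pi>)) \<le> \<delta>"
        using \<delta>[of i q] i q by (simp add: I_def)
    qed
    also have "\<dots> = 2 * \<delta>"
      using i by (auto simp: I_def)
    finally have "norm (perm_avg n (\<lambda>\<pi>. peak_dev n i \<pi> *\<^sub>R K i \<pi>)) \<le> 2 * \<delta> / 3"
      using perm_avg_peak_dev_approx[of i n "K i"] i by (simp add: I_def)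
    moreover have "\<delta> \<ge> 0"
      using calculation norm_ge_zero[of "perm_avg n (\<lambda>\<pi>. peak_dev n i \<pi> *\<^sub>R K i \<pi>)"] by linarith
    ultimately show ?thesis
      by linarith
  qed
  have cI: "real (card I) \<le> n"
    by (simp add: I_def)
  have \<delta>0: "\<delta> \<ge> 0"
    using order.trans[OF norm_ge_zero main[of 2]] n by (simp add: I_def)

  have "norm (\<i> * (\<Sum>i\<in>I. perm_avg n (\<lambda>\<pi>. peak_dev n i \<pi> *\<^sub>R K i \<pi>))) \<le> (\<Sum>i\<in>I. \<delta>)"
    unfolding norm_mult using main by (simp only: norm_ii mult_1) (rule sum_norm_le)
  also have "\<dots> \<le> n * \<delta>"
    using mult_right_mono[OF cI \<delta>0] by simp
  finally have b1: "norm (perm_avg n (\<lambda>\<pi>. \<i> * (\<Sum>i\<in>I. peak_dev n i \<pi> *\<^sub>R K i \<pi>))) \<le> n * \<delta>"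
    by (simp only: perm_avg_cmult perm_avg_sum)

  have "norm (perm_avg n (\<lambda>\<pi>. ((v - close_prod_sum n \<pi>) * r) * (e \<pi> * g \<pi>)))
      \<le> perm_avg n (\<lambda>\<pi>. norm (((v - close_prod_sum n \<pi>) * r) * (e \<pi> * g \<pi>)))"
    by (rule norm_perm_avg_le)
  also have "\<dots> \<le> perm_avg n (\<lambda>\<pi>. \<bar>r\<bar> * \<bar>close_prod_sum n \<pi> - v\<bar>)"
  proof (rule perm_avg_mono)
    fix \<pi>
    have "norm (((v - close_prod_sum n \<pi>) * r) * (e \<pi> * g \<pi>)) = (\<bar>r\<bar> * \<bar>close_prod_sum n \<pi> - v\<bar>) * norm (g \<pi>)"
      unfolding norm_mult norm_of_real norm_e by (simp add: abs_mult abs_minus_commute)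
    also have "\<dots> \<le> (\<bar>r\<bar> * \<bar>close_prod_sum n \<pi> - v\<bar>) * 1"
      by (intro mult_left_mono g) auto
    finally show "norm (((v - close_prod_sum n \<pi>) * r) * (e \<pi> * g \<pi>)) \<le> \<bar>r\<bar> * \<bar>close_prod_sum n \<pi> - v\<bar>"
      by simp
  qed
  also have "\<dots> = \<bar>r\<bar> * perm_avg n (\<lambda>\<pi>. \<bar>close_prod_sum n \<pi> - v\<bar>)"
    by (rule perm_avg_cmult)
  also have "\<dots> \<le> \<bar>r\<bar> * (163 * sqrt n)"
    unfolding v_def by (intro mult_left_mono perm_avg_close_prod_sum_deviation n) auto
  finally have b2: "norm (perm_avg n (\<lambda>\<pi>. ((v - close_prod_sum n \<pi>) * r) * (e \<pi> * g \<pi>))) \<le> 163 * sqrt n * \<bar>r\<bar>"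
    by (simp add: mult_ac)

  have "norm (perm_avg n (\<lambda>\<pi>. \<i> * (\<Sum>i\<in>I. peak_dev n i \<pi> *\<^sub>R (\<rho> i \<pi> * (e \<pi> * g \<pi>)))))
      \<le> perm_avg n (\<lambda>\<pi>. norm (\<i> * (\<Sum>i\<in>I. peak_dev n i \<pi> *\<^sub>R (\<rho> i \<pi> * (e \<pi> * g \<pi>)))))"
    by (rule norm_perm_avg_le)
  also have "\<dots> \<le> perm_avg n (\<lambda>\<pi>. \<Sum>i\<in>I. 13 * r\<^sup>2)"
  proof (rule perm_avg_mono)
    fix \<pi>
    have "norm (peak_dev n i \<pi> *\<^sub>R (\<rho> i \<pi> * (e \<pi> * g \<pi>))) \<le> 13 * r\<^sup>2" for i
    proof -
      have "norm (peak_dev n i \<pi> *\<^sub>R (\<rho> i \<pi> * (e \<pi> * g \<pi>))) = \<bar>peak_dev n i \<pi>\<bar> * (norm (\<rho> i \<pi>) * norm (g \<pi>))"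
        by (simp add: norm_mult norm_e)
      also have "\<dots> \<le> 1 * (13 * r\<^sup>2 * 1)"
        by (intro mult_mono \<rho>_le g order.trans[OF abs_peak_dev_le]) auto
      finally show ?thesis
        by simp
    qed
    then show "norm (\<i> * (\<Sum>i\<in>I. peak_dev n i \<pi> *\<^sub>R (\<rho> i \<pi> * (e \<pi> * g \<pi>)))) \<le> (\<Sum>i\<in>I. 13 * r\<^sup>2)"
      unfolding norm_mult by (simp only: norm_ii mult_1) (rule sum_norm_le)
  qed
  also have "\<dots> = real (card I) * (13 * r\<^sup>2)"
    by (simp add: perm_avg_const)
  also have "\<dots> \<le> 13 * n * r\<^sup>2"
    using mult_right_mono[OF cI, of "13 * r\<^sup>2"] by (simp add: mult_ac)
  finally have b3: "norm (perm_avg n (\<lambda>\<pi>. \<i> * (\<Sum>i\<in>I. peak_dev n i \<pi> *\<^sub>R (\<rho> i \<pi> * (e \<pi> * g \<pi>)))))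
      \<le> 13 * n * r\<^sup>2" .

  have "perm_avg n (\<lambda>\<pi>. \<i> * peak_sum n \<pi> * e \<pi> * g \<pi>) + (v * r) * peak_cf n g r =
      perm_avg n (\<lambda>\<pi>. \<i> * peak_sum n \<pi> * e \<pi> * g \<pi> + (v * r) * (e \<pi> * g \<pi>))"
    unfolding peak_cf_def e_def[symmetric] by (simp only: perm_avg_add perm_avg_cmult)
  also have "\<dots> = perm_avg n (\<lambda>\<pi>. \<i> * (\<Sum>i\<in>I. peak_dev n i \<pi> *\<^sub>R K i \<pi>))
      + perm_avg n (\<lambda>\<pi>. ((v - close_prod_sum n \<pi>) * r) * (e \<pi> * g \<pi>))
      + perm_avg n (\<lambda>\<pi>. \<i> * (\<Sum>i\<in>I. peak_dev n i \<pi> *\<^sub>R (\<rho> i \<pi> * (e \<pi> * g \<pi>))))"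
    unfolding pointwise perm_avg_add ..
  finally have "norm (perm_avg n (\<lambda>\<pi>. \<i> * peak_sum n \<pi> * e \<pi> * g \<pi>) + (v * r) * peak_cf n g r)
      \<le> n * \<delta> + 163 * sqrt n * \<bar>r\<bar> + 13 * n * r\<^sup>2"
    using b1 b2 b3 by (auto intro!: norm_triangle_le add_mono)
  then show ?thesis
    by (simp add: e_def v_def)
qed

section \<open>The effect of a transposition on the peaks of the inverse\<close>

lemma transpose_adjacent_less_iff:
  fixes i q u v :: nat
  assumes "q = i + 1 \<or> i = q + 1" "u \<noteq> v" "{u, v} \<noteq> {i, q}"
  shows "Transposition.transpose i q u < Transposition.transpose i q v \<longleftrightarrow> u < v"
  using assms by (auto simp: Transposition.transpose_def)

abbreviation consecutive_values :: "(nat \<Rightarrow> nat) \<Rightarrow> nat \<Rightarrow> nat \<Rightarrow> bool" where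
  "consecutive_values \<pi> i q \<equiv> \<pi> q = \<pi> i + 1 \<or> \<pi> i = \<pi> q + 1"

text \<open>
  Composing \<open>\<pi>\<close> with the transposition of two adjacent positions exchanges the adjacent numbers \<open>i\<close>
  and \<open>q\<close> in the word of the inverse. No comparison with a third number is affected, so neighbouring
  entries of this word compare differently only if \<open>i\<close> and \<open>q\<close> are neighbours there, that is, if
  \<open>\<pi> i\<close> and \<open>\<pi> q\<close> are consecutive; and then only these two places can gain or lose a peak.
\<close>

lemma peak_sum_inv_transpose_diff:
  assumes \<pi>: "\<pi> permutes {1..n}" and iq: "i \<in> {1..n}" "q \<in> {1..n}" "q = i + 1 \<or> i = q + 1"
  shows "\<bar>peak_sum n (inv (\<pi> \<circ> Transposition.transpose i q)) - peak_sum n (inv \<pi>)\<bar>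
    \<le> 2 * of_bool (consecutive_values \<pi> i q)"
proof -
  define \<tau> where "\<tau> = Transposition.transpose i q"
  define \<rho> where "\<rho> = inv \<pi>"
  have inv_eq: "inv (\<pi> \<circ> \<tau>) = \<tau> \<circ> \<rho>"
    unfolding \<tau>_def \<rho>_def using permutes_bij[OF \<pi>] by (simp add: o_inv_distrib)
  have \<pi>\<rho>: "\<pi> (\<rho> k) = k" for k
    unfolding \<rho>_def using permutes_inverses(1)[OF \<pi>] .
  have \<rho>_eq: "\<rho> k = x \<longleftrightarrow> k = \<pi> x" for k x
    using \<pi>\<rho> permutes_inverses(2)[OF \<pi>] unfolding \<rho>_def by metis
  have less: "\<tau> (\<rho> k) < \<tau> (\<rho> l) \<longleftrightarrow> \<rho> k < \<rho> l" if "k \<noteq> l" "{k, l} \<noteq> {\<pi> i, \<pi> q}" for k l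
    unfolding \<tau>_def
  proof (rule transpose_adjacent_less_iff[OF iq(3)])
    show "\<rho> k \<noteq> \<rho> l"
      using that \<pi>\<rho> by metis
    show "{\<rho> k, \<rho> l} \<noteq> {i, q}"
      using that(2) by (auto simp: doubleton_eq_iff \<rho>_eq)
  qed
  have same: "peak_dev n k (\<tau> \<circ> \<rho>) = peak_dev n k \<rho>"
    if "\<not> (consecutive_values \<pi> i q \<and> k \<in> {\<pi> i, \<pi> q})" for k
  proof (cases "k \<in> {2..n - 1}")
    case True
    then have "k - 1 \<noteq> k" "k \<noteq> k + 1" "{k - 1, k} \<noteq> {\<pi> i, \<pi> q}" "{k + 1, k} \<noteq> {\<pi> i, \<pi> q}"
      using that by (auto simp: doubleton_eq_iff)
    then have "\<tau> (\<rho> (k - 1)) < \<tau> (\<rho> k) \<longleftrightarrow> \<rho> (k - 1) < \<rho> k" "\<tau> (\<rho> (k + 1)) < \<tau> (\<rho> k) \<longleftrightarrow> \<rho> (k + 1) < \<rho> k"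
      using less[of "k - 1" k] less[of "k + 1" k] by auto
    then show ?thesis
      by (simp add: peak_dev_def peaks_def)
  qed (auto simp: peak_dev_def peaks_def)
  have "\<bar>peak_sum n (\<tau> \<circ> \<rho>) - peak_sum n \<rho>\<bar> \<le> (\<Sum>k\<in>{2..n - 1}. \<bar>peak_dev n k (\<tau> \<circ> \<rho>) - peak_dev n k \<rho>\<bar>)"
    unfolding peak_sum_def sum_subtractf[symmetric] by (rule sum_abs)
  also have "\<dots> \<le> (\<Sum>k\<in>{2..n - 1}. if k \<in> {\<pi> i, \<pi> q} then of_bool (consecutive_values \<pi> i q) else 0)"
  proof (rule sum_mono)
    fix k
    show "\<bar>peak_dev n k (\<tau> \<circ> \<rho>) - peak_dev n k \<rho>\<bar> \<le> (if k \<in> {\<pi> i, \<pi> q} then of_bool (consecutive_values \<pi> i q) else 0)"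
    proof (cases "consecutive_values \<pi> i q \<and> k \<in> {\<pi> i, \<pi> q}")
      case True
      then show ?thesis
        by (simp add: peak_dev_def)
    next
      case False
      then show ?thesis
        using same[of k] by simp
    qed
  qed
  also have "\<dots> = (\<Sum>k\<in>{2..n - 1} \<inter> {\<pi> i, \<pi> q}. of_bool (consecutive_values \<pi> i q))"
    by (subst sum.inter_restrict) auto
  also have "\<dots> \<le> (\<Sum>k\<in>{\<pi> i, \<pi> q}. of_bool (consecutive_values \<pi> i q))"
    by (intro sum_mono2) auto
  also have "\<dots> \<le> 2 * of_bool (consecutive_values \<pi> i q)"
    by (simp add: card_insert_if)
  finally show ?thesis
    unfolding inv_eq \<tau>_def[symmetric] \<rho>_def[symmetric] .
qed

text \<open>
  By symmetry all \<open>n - 1\<close> choices of \<open>q\<close> are equally likely to work, and at most two work at the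
  same time.
\<close>

lemma perm_avg_consecutive_values_le:
  assumes i: "i \<in> {1..n}" and q: "q \<in> {1..n}" "q \<noteq> i"
  shows "perm_avg n (\<lambda>\<pi>. of_bool (consecutive_values \<pi> i q)) \<le> 2 / (real n - 1)"
proof -
  let ?P = "\<lambda>q. perm_avg n (\<lambda>\<pi>. of_bool (consecutive_values \<pi> i q) :: real)"
  have same: "?P p = ?P q" if p: "p \<in> {1..n} - {i}" for p
  proof -
    have "Transposition.transpose p q permutes {1..n}"
      using p q by (intro permutes_swap_id) auto
    from perm_avg_compose_right[OF this, of "\<lambda>\<pi>. of_bool (consecutive_values \<pi> i q) :: real"]
    show ?thesis
      using p q by (simp add: transpose_apply_other)
  qed
  have n: "real n - 1 > 0"
    using i q by auto
  have "(real n - 1) * ?P q = (\<Sum>p\<in>{1..n} - {i}. ?P p)"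
    using i n same by (simp add: card_Diff_singleton of_nat_diff)
  also have "\<dots> = perm_avg n (\<lambda>\<pi>. \<Sum>p\<in>{1..n} - {i}. of_bool (consecutive_values \<pi> i p))"
    by (rule perm_avg_sum[symmetric])
  also have "\<dots> \<le> perm_avg n (\<lambda>\<pi>. 2)"
  proof (rule perm_avg_mono)
    fix \<pi> assume \<pi>: "\<pi> permutes {1..n}"
    have "(\<Sum>p\<in>{1..n} - {i}. of_bool (consecutive_values \<pi> i p)) =
        real (card {p \<in> {1..n} - {i}. consecutive_values \<pi> i p})"
      by (subst sum_of_bool_eq) (auto intro!: arg_cong[where f = card])
    also have "card {p \<in> {1..n} - {i}. consecutive_values \<pi> i p} \<le> card {\<pi> i + 1, \<pi> i - 1}"
      by (rule card_inj_on_le[where f = \<pi>]) (auto intro: inj_on_subset[OF permutes_inj[OF \<pi>]])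
    also have "\<dots> \<le> 2"
      by (simp add: card_insert_if)
    finally show "(\<Sum>p\<in>{1..n} - {i}. of_bool (consecutive_values \<pi> i p)) \<le> (2::real)"
      by simp
  qed
  finally show ?thesis
    using n by (simp add: perm_avg_const field_simps)
qed

lemma perm_avg_inv_cf_transpose_diff:
  assumes i: "i \<in> {2..n - 1}" and q: "q \<in> {i - 1, i + 1}"
  shows "perm_avg n (\<lambda>\<pi>. norm (iexp (t * peak_sum n (inv (\<pi> \<circ> Transposition.transpose i q)))
      - iexp (t * peak_sum n (inv \<pi>)))) \<le> 4 * \<bar>t\<bar> / (real n - 1)"
proof -
  have iq: "i \<in> {1..n}" "q \<in> {1..n}" "q = i + 1 \<or> i = q + 1" "q \<noteq> i"
    using i q by auto
  have "perm_avg n (\<lambda>\<pi>. norm (iexp (t * peak_sum n (inv (\<pi> \<circ> Transposition.transpose i q)))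
      - iexp (t * peak_sum n (inv \<pi>)))) \<le> perm_avg n (\<lambda>\<pi>. (2 * \<bar>t\<bar>) * of_bool (consecutive_values \<pi> i q))"
  proof (rule perm_avg_mono)
    fix \<pi> assume \<pi>: "\<pi> permutes {1..n}"
    have "norm (iexp (t * peak_sum n (inv (\<pi> \<circ> Transposition.transpose i q))) - iexp (t * peak_sum n (inv \<pi>)))
        \<le> \<bar>t * peak_sum n (inv (\<pi> \<circ> Transposition.transpose i q)) - t * peak_sum n (inv \<pi>)\<bar>"
      by (rule norm_iexp_diff_le)
    also have "\<dots> = \<bar>t\<bar> * \<bar>peak_sum n (inv (\<pi> \<circ> Transposition.transpose i q)) - peak_sum n (inv \<pi>)\<bar>"
      by (simp add: abs_mult flip: right_diff_distrib)
    also have "\<dots> \<le> \<bar>t\<bar> * (2 * of_bool (consecutive_values \<pi> i q))"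
      by (intro mult_left_mono peak_sum_inv_transpose_diff[OF \<pi> iq(1-3)]) auto
    finally show "norm (iexp (t * peak_sum n (inv (\<pi> \<circ> Transposition.transpose i q)))
        - iexp (t * peak_sum n (inv \<pi>))) \<le> (2 * \<bar>t\<bar>) * of_bool (consecutive_values \<pi> i q)"
      by (simp only: mult_ac)
  qed
  also have "\<dots> = (2 * \<bar>t\<bar>) * perm_avg n (\<lambda>\<pi>. of_bool (consecutive_values \<pi> i q))"
    by (rule perm_avg_cmult)
  also have "\<dots> \<le> (2 * \<bar>t\<bar>) * (2 / (real n - 1))"
    by (intro mult_left_mono perm_avg_consecutive_values_le iq) auto
  finally show ?thesis
    by simp
qed

section \<open>Solving the approximate Stein equation\<close>

text \<open>
  The integrating factor \<open>exp(v u\<^sup>2/2)\<close> turns the differential equation \<open>\<phi>' = - v u \<phi>\<close> into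
  the constancy of \<open>exp(v u\<^sup>2/2) \<phi>\<close>. As this factor is largest at \<open>u = r\<close>, it cancels from the error
  after the mean value inequality.
\<close>

lemma gaussian_ode_bound:
  fixes \<phi> D :: "real \<Rightarrow> complex" and v r B :: real
  assumes deriv: "\<And>u. u \<in> closed_segment 0 r \<Longrightarrow> (\<phi> has_vector_derivative D u) (at u within closed_segment 0 r)"
    and bound: "\<And>u. u \<in> closed_segment 0 r \<Longrightarrow> norm (D u + (v * u) * \<phi> u) \<le> B"
    and v: "v \<ge> 0"
  shows "norm (\<phi> r - exp (- (v * r\<^sup>2 / 2)) * \<phi> 0) \<le> B * \<bar>r\<bar>"
proof -
  let ?S = "closed_segment 0 r"
  define h where "h u = exp (v * u\<^sup>2 / 2) *\<^sub>R \<phi> u" for u :: real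
  define H where "H u = exp (v * u\<^sup>2 / 2) *\<^sub>R (D u + (v * u) * \<phi> u)" for u :: real
  define E where "E = exp (v * r\<^sup>2 / 2)"
  have dh: "(h has_derivative (\<lambda>x. x *\<^sub>R H u)) (at u within ?S)" if "u \<in> ?S" for u
  proof -
    have "((\<lambda>u. exp (v * u\<^sup>2 / 2)) has_real_derivative exp (v * u\<^sup>2 / 2) * (v * u)) (at u within ?S)"
      by (auto intro!: derivative_eq_intros)
    from has_vector_derivative_scaleR[OF this deriv[OF that]]
    have "(h has_vector_derivative H u) (at u within ?S)"
      unfolding h_def H_def by (simp add: scaleR_conv_of_real algebra_simps)
    then show ?thesis
      by (simp add: has_vector_derivative_def)
  qed
  have HB: "norm (H u) \<le> E * B" if u: "u \<in> ?S" for u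
  proof -
    have "\<bar>u\<bar> \<le> \<bar>r\<bar>"
      using u by (auto simp: closed_segment_eq_real_ivl split: if_splits)
    then have "u\<^sup>2 \<le> r\<^sup>2"
      by (simp add: abs_le_square_iff)
    then have "exp (v * u\<^sup>2 / 2) \<le> E"
      unfolding E_def using v by (simp add: mult_left_mono)
    then show ?thesis
      unfolding H_def norm_scaleR using bound[OF u] by (intro mult_mono) (auto simp: E_def)
  qed
  have "norm (h r - h 0) \<le> (E * B) * norm (r - 0)"
  proof (rule differentiable_bound[OF _ dh])
    show "onorm (\<lambda>x. x *\<^sub>R H u) \<le> E * B" if "u \<in> ?S" for u
      using HB[OF that] by (intro onorm_le) (simp add: mult.commute[of _ "E * B"] mult.commute[of _ "norm (H u)"] mult_right_mono)
  qed auto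
  moreover have "h r - h 0 = E *\<^sub>R (\<phi> r - exp (- (v * r\<^sup>2 / 2)) * \<phi> 0)"
    unfolding h_def E_def by (simp add: scaleR_conv_of_real exp_minus field_simps)
  ultimately have "E * norm (\<phi> r - exp (- (v * r\<^sup>2 / 2)) * \<phi> 0) \<le> E * (B * \<bar>r\<bar>)"
    by (simp add: E_def)
  then show ?thesis
    by (simp add: E_def)
qed

lemma peak_cf_gaussian_approx:
  fixes g :: "(nat \<Rightarrow> nat) \<Rightarrow> complex"
  assumes n: "n \<ge> 4"
    and g: "\<And>\<pi>. norm (g \<pi>) \<le> 1"
    and \<delta>: "\<And>i q. i \<in> {2..n - 1} \<Longrightarrow> q \<in> {i - 1, i + 1} \<Longrightarrow>
      perm_avg n (\<lambda>\<pi>. norm (g (\<pi> \<circ> Transposition.transpose i q) - g \<pi>)) \<le> \<delta>"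
  shows "norm (peak_cf n g r - exp (- (2 * (real n + 1) / 45 * r\<^sup>2 / 2)) * perm_avg n g)
    \<le> (n * \<delta> + 13 * n * r\<^sup>2 + 163 * sqrt n * \<bar>r\<bar>) * \<bar>r\<bar>"
proof -
  have "norm (perm_avg n (\<lambda>\<pi>. \<i> * peak_sum n \<pi> * iexp (u * peak_sum n \<pi>) * g \<pi>)
      + (2 * (real n + 1) / 45 * u) * peak_cf n g u) \<le> n * \<delta> + 13 * n * r\<^sup>2 + 163 * sqrt n * \<bar>r\<bar>"
    if u: "u \<in> closed_segment 0 r" for u
  proof -
    have ur: "\<bar>u\<bar> \<le> \<bar>r\<bar>"
      using u by (auto simp: closed_segment_eq_real_ivl split: if_splits)
    then have "u\<^sup>2 \<le> r\<^sup>2"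
      by (simp add: abs_le_square_iff)
    with ur have "n * \<delta> + 13 * n * u\<^sup>2 + 163 * sqrt n * \<bar>u\<bar> \<le> n * \<delta> + 13 * n * r\<^sup>2 + 163 * sqrt n * \<bar>r\<bar>"
      by (intro add_mono mult_left_mono) auto
    then show ?thesis
      using peak_cf_stein_bound[where g = g and \<delta> = \<delta> and r = u, OF n g \<delta>] by linarith
  qed
  from gaussian_ode_bound[OF peak_cf_has_vector_derivative this]
  show ?thesis
    by (simp add: peak_cf_def[of n g 0])
qed

section \<open>A continuity theorem in the plane\<close>

text \<open>
  Complex combinations of the plane waves, that is, of the functions whose integrals are the values of
  the characteristic function.
\<close>

inductive trig_polynomial2 :: "(real \<times> real \<Rightarrow> complex) \<Rightarrow> bool" where
  wave: "trig_polynomial2 (\<lambda>p. iexp (s * fst p + t * snd p))"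
| add: "trig_polynomial2 F \<Longrightarrow> trig_polynomial2 G \<Longrightarrow> trig_polynomial2 (\<lambda>p. F p + G p)"
| cmult: "trig_polynomial2 F \<Longrightarrow> trig_polynomial2 (\<lambda>p. c * F p)"

lemma trig_polynomial2_mult:
  assumes "trig_polynomial2 F" "trig_polynomial2 G"
  shows "trig_polynomial2 (\<lambda>p. F p * G p)"
  using assms(1)
proof induction
  case (wave s t)
  show ?case
    using assms(2)
  proof induction
    case (wave s' t')
    have "iexp (s * fst p + t * snd p) * iexp (s' * fst p + t' * snd p) =
        iexp ((s + s') * fst p + (t + t') * snd p)" for p
      unfolding iexp_add[symmetric] by (simp add: algebra_simps)
    then show ?case
      by (simp only: trig_polynomial2.wave)
  next
    case (add F G)
    then show ?case
      by (simp only: distrib_left trig_polynomial2.add)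
  next
    case (cmult F c)
    then show ?case
      by (simp only: mult.left_commute[of _ c] trig_polynomial2.cmult)
  qed
next
  case (add F G)
  then show ?case
    by (simp only: distrib_right trig_polynomial2.add)
next
  case (cmult F c)
  then show ?case
    by (simp only: mult.assoc trig_polynomial2.cmult)
qed

lemma trig_polynomial2_const: "trig_polynomial2 (\<lambda>p. c)"
  using trig_polynomial2.cmult[OF trig_polynomial2.wave[of 0 0], of c] by simp

lemma of_real_sin_iexp: "complex_of_real (sin x) = (- \<i> / 2) * iexp x + (\<i> / 2) * iexp (- x)"
  unfolding sin_of_real[symmetric] sin_exp_eq by (simp add: field_simps)

lemma trig_polynomial2_sin:
  "trig_polynomial2 (\<lambda>p. of_real (sin (fst p / c)))" "trig_polynomial2 (\<lambda>p. of_real (sin (snd p / c)))"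
proof -
  have "trig_polynomial2 (\<lambda>p. of_real (sin (s * fst p + t * snd p)))" for s t
  proof -
    have "- (s * fst p + t * snd p) = (- s) * fst p + (- t) * snd p" for p :: "real \<times> real"
      by (simp only: minus_add_distrib mult_minus_left)
    then have "(\<lambda>p. complex_of_real (sin (s * fst p + t * snd p))) = (\<lambda>p. (- \<i> / 2) * iexp (s * fst p + t * snd p)
        + (\<i> / 2) * iexp ((- s) * fst p + (- t) * snd p))"
      by (simp only: of_real_sin_iexp)
    then show ?thesis
      by (simp only:)
        (rule trig_polynomial2.add[OF trig_polynomial2.cmult[OF trig_polynomial2.wave]
            trig_polynomial2.cmult[OF trig_polynomial2.wave]])
  qed
  from this[of "1 / c" 0] this[of 0 "1 / c"]
  show "trig_polynomial2 (\<lambda>p. of_real (sin (fst p / c)))" "trig_polynomial2 (\<lambda>p. of_real (sin (snd p / c)))"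
    by (simp_all only: mult_zero_left add_0_right add_0_left times_divide_eq_left mult_1_left)
qed

text \<open>
  The approximants for the continuity theorem: they are controlled by the characteristic function
  and, the sine being bounded, stay bounded on the whole plane.
\<close>

lemma trig_polynomial2_of_polynomial:
  assumes "real_polynomial_function (P :: real \<times> real \<Rightarrow> real)"
  shows "trig_polynomial2 (\<lambda>p. of_real (P (sin (fst p / c), sin (snd p / c))))"
  using assms
proof induction
  case (linear f)
  have f: "f (x, y) = f (1, 0) * x + f (0, 1) * y" for x y
  proof -
    interpret bounded_linear f by fact
    have "f (x, y) = f (x *\<^sub>R (1, 0) + y *\<^sub>R (0, 1))"
      by simp
    also have "\<dots> = f (1, 0) * x + f (0, 1) * y"
      unfolding add scaleR by simp
    finally show ?thesis .
  qed
  have "(\<lambda>p. complex_of_real (f (sin (fst p / c), sin (snd p / c)))) =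
      (\<lambda>p. of_real (f (1, 0)) * of_real (sin (fst p / c)) + of_real (f (0, 1)) * of_real (sin (snd p / c)))"
    by (rule ext, subst f) simp
  then show ?case
    by (simp only:) (intro trig_polynomial2.add trig_polynomial2.cmult trig_polynomial2_sin)
qed (auto intro: trig_polynomial2_const trig_polynomial2.add trig_polynomial2_mult)

lemma trig_polynomial2_integrable:
  assumes "trig_polynomial2 F" "finite_measure M" and "sets M = sets borel"
  shows "integrable M F"
  using assms(1)
proof induction
  case (wave s t)
  interpret finite_measure M by fact
  have "(\<lambda>p. iexp (s * fst p + t * snd p)) \<in> borel_measurable borel"
    by (intro borel_measurable_continuous_onI continuous_intros)
  then have "(\<lambda>p. iexp (s * fst p + t * snd p)) \<in> borel_measurable M"
    by (simp only: measurable_cong_sets[OF assms(3) refl])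
  then show ?case
    by (intro integrable_const_bound[where B = 1]) auto
qed auto

text \<open>
  In the coordinates \<open>u = sin(x/c)\<close>, \<open>v = sin(y/c)\<close> the test function \<open>f\<close> becomes a continuous function
  on the square, namely \<open>f(c arcsin u, c arcsin v)\<close>, which agrees with \<open>f\<close> on the disc of radius \<open>c\<close>. A
  Weierstrass approximation of it on the square is a trigonometric polynomial in \<open>(x, y)\<close> that is bounded
  everywhere and close to \<open>f\<close> on that disc. Outside the disc, the error is at most a constant multiple of
  \<open>|(x, y)|\<^sup>2/c\<^sup>2\<close>, whose integral is small for large \<open>c\<close>, uniformly in \<open>n\<close>, by the bound on the second
  moments.
\<close>

theorem levy_continuity_plane:
  fixes \<mu> :: "nat \<Rightarrow> (real \<times> real) measure"
  assumes \<mu>: "\<And>n. prob_space (\<mu> n)" "\<And>n. sets (\<mu> n) = sets borel"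
    and \<nu>: "prob_space \<nu>" "sets \<nu> = sets borel"
    and cf: "\<And>s t. (\<lambda>n. \<integral>p. iexp (s * fst p + t * snd p) \<partial>\<mu> n) \<longlonglongrightarrow> (\<integral>p. iexp (s * fst p + t * snd p) \<partial>\<nu>)"
    and mom_\<mu>: "eventually (\<lambda>n. integrable (\<mu> n) (\<lambda>p. (norm p)\<^sup>2) \<and> (\<integral>p. (norm p)\<^sup>2 \<partial>\<mu> n) \<le> C) sequentially"
    and mom_\<nu>: "integrable \<nu> (\<lambda>p. (norm p)\<^sup>2)" "(\<integral>p. (norm p)\<^sup>2 \<partial>\<nu>) \<le> C"
  shows "weak_conv_meas \<mu> \<nu>"
  unfolding weak_conv_meas_def
proof (intro allI impI)
  fix f :: "real \<times> real \<Rightarrow> real"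
  assume f: "continuous_on UNIV f" "bounded (range f)"
  obtain B where B: "\<And>p. \<bar>f p\<bar> \<le> B" "B > 0"
    using f(2) by (auto simp: bounded_pos)
  have f_meas: "f \<in> borel_measurable borel"
    using f(1) by (rule borel_measurable_continuous_onI)
  have approx: "\<exists>P. real_polynomial_function P \<and>
      (\<forall>p. \<bar>f p - P (sin (fst p / c), sin (snd p / c))\<bar> \<le> \<epsilon> + 2 * B / c\<^sup>2 * (norm p)\<^sup>2)"
    if "\<epsilon> > 0" "c > 0" for \<epsilon> c
  proof -
    define Q :: "(real \<times> real) set" where "Q = {-1..1} \<times> {-1..1}"
    define F where "F p = f (c * arcsin (fst p), c * arcsin (snd p))" for p
    have "continuous_on Q (\<lambda>p. (c * arcsin (fst p), c * arcsin (snd p)))"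
      unfolding Q_def by (intro continuous_intros) auto
    then have "continuous_on Q F"
      unfolding F_def by (rule continuous_on_compose2[OF f(1)]) auto
    moreover have "compact Q"
      unfolding Q_def by (intro compact_Times compact_Icc)
    ultimately obtain P where P: "real_polynomial_function P" "\<And>p. p \<in> Q \<Longrightarrow> \<bar>F p - P p\<bar> < \<epsilon>"
      using Stone_Weierstrass_real_polynomial_function \<open>\<epsilon> > 0\<close> by metis
    have "\<bar>f p - P (sin (fst p / c), sin (snd p / c))\<bar> \<le> \<epsilon> + 2 * B / c\<^sup>2 * (norm p)\<^sup>2" for p
    proof -
      define S where "S = (sin (fst p / c), sin (snd p / c))"
      have FP: "\<bar>F S - P S\<bar> < \<epsilon>"
        by (intro P(2)) (auto simp: S_def Q_def)
      show ?thesis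
      proof (cases "norm p \<le> c")
        case True
        have "c * arcsin (sin (x / c)) = x" if "\<bar>x\<bar> \<le> c" for x
        proof -
          have "x / c \<le> 1" "- 1 \<le> x / c"
            using that \<open>c > 0\<close> by (auto simp: field_simps)
          then have "arcsin (sin (x / c)) = x / c"
            using pi_ge_two by (intro arcsin_sin) linarith+
          then show ?thesis
            using \<open>c > 0\<close> by simp
        qed
        moreover have "\<bar>fst p\<bar> \<le> c" "\<bar>snd p\<bar> \<le> c"
          using norm_fst_le[of "fst p" "snd p"] norm_snd_le[of "snd p" "fst p"] True by auto
        ultimately have "F S = f p"
          by (simp add: F_def S_def)
        moreover have "0 \<le> 2 * B / c\<^sup>2 * (norm p)\<^sup>2"
          using B(2) by simp
        ultimately show ?thesis
          using FP unfolding S_def by linarith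
      next
        case False
        then have "c\<^sup>2 \<le> (norm p)\<^sup>2"
          using \<open>c > 0\<close> by (intro power_mono) auto
        then have "2 * B \<le> 2 * B / c\<^sup>2 * (norm p)\<^sup>2"
          using \<open>c > 0\<close> B(2) by (simp add: field_simps)
        moreover have "\<bar>f p - F S\<bar> \<le> 2 * B"
          using B(1)[of p] B(1)[of "(c * arcsin (fst S), c * arcsin (snd S))"] by (simp add: F_def)
        ultimately show ?thesis
          using FP unfolding S_def by linarith
      qed
    qed
    with P(1) show ?thesis
      by blast
  qed

  show "(\<lambda>n. integral\<^sup>L (\<mu> n) f) \<longlonglongrightarrow> integral\<^sup>L \<nu> f"
  proof (rule tendstoI)
    fix \<epsilon> :: real assume "\<epsilon> > 0"
    define \<eta> where "\<eta> = \<epsilon> / 5"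
    have \<eta>: "\<eta> > 0"
      using \<open>\<epsilon> > 0\<close> by (simp add: \<eta>_def)
    \<comment> \<open>For each of the two measures, the approximation on the square costs \<open>\<eta>\<close> and the part of the
        plane outside the disc costs \<open>\<eta>\<close>; the convergence of the approximants costs another \<open>\<eta>\<close>.\<close>
    define c where "c = max 1 (2 * B * C / \<eta>)"
    have c: "c \<ge> 1" "2 * B * C / \<eta> \<le> c"
      by (auto simp: c_def)
    have "2 * B * C \<le> \<eta> * c"
      using c(2) \<eta> by (simp add: field_simps)
    also have "\<dots> \<le> \<eta> * c\<^sup>2"
      using c(1) \<eta> by (intro mult_left_mono) (auto simp: power2_eq_square)
    finally have c_tail: "2 * B / c\<^sup>2 * C \<le> \<eta>"
      using c(1) by (simp add: field_simps)
    obtain P where P: "real_polynomial_function P"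
      "\<And>p. \<bar>f p - P (sin (fst p / c), sin (snd p / c))\<bar> \<le> \<eta> + 2 * B / c\<^sup>2 * (norm p)\<^sup>2"
      using approx[OF \<eta>, of c] c(1) by auto
    define G where "G p = P (sin (fst p / c), sin (snd p / c))" for p
    have trig: "trig_polynomial2 (\<lambda>p. of_real (G p))"
      unfolding G_def by (rule trig_polynomial2_of_polynomial[OF P(1)])
    have close: "integrable M G" "\<bar>integral\<^sup>L M f - integral\<^sup>L M G\<bar> \<le> 2 * \<eta>"
      if M: "prob_space M" "sets M = sets borel" "integrable M (\<lambda>p. (norm p)\<^sup>2)" "(\<integral>p. (norm p)\<^sup>2 \<partial>M) \<le> C" for M
    proof -
      interpret prob_space M by fact
      have iG: "integrable M (\<lambda>p. complex_of_real (G p))"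
        using trig finite_measure_axioms M(2) by (rule trig_polynomial2_integrable)
      then show G: "integrable M G"
        by (simp add: complex_of_real_integrable_eq)
      have f': "integrable M f"
        using f_meas B(1) M(2) by (intro integrable_const_bound[where B = B]) (auto cong: measurable_cong_sets)
      have "\<bar>integral\<^sup>L M f - integral\<^sup>L M G\<bar> = \<bar>\<integral>p. f p - G p \<partial>M\<bar>"
        using f' G by simp
      also have "\<dots> \<le> (\<integral>p. \<bar>f p - G p\<bar> \<partial>M)"
        by (rule integral_abs_bound)
      also have "\<dots> \<le> (\<integral>p. \<eta> + 2 * B / c\<^sup>2 * (norm p)\<^sup>2 \<partial>M)"
      proof (rule integral_mono)
        show "integrable M (\<lambda>p. \<bar>f p - G p\<bar>)"
          using f' G by simp
        show "integrable M (\<lambda>p. \<eta> + 2 * B / c\<^sup>2 * (norm p)\<^sup>2)"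
          using M(3) by simp
      qed (simp only: G_def P(2))
      also have "\<dots> = \<eta> + 2 * B / c\<^sup>2 * (\<integral>p. (norm p)\<^sup>2 \<partial>M)"
        using M(3) by (simp add: prob_space)
      also have "\<dots> \<le> \<eta> + 2 * B / c\<^sup>2 * C"
        using M(4) B(2) by (intro add_left_mono mult_left_mono) auto
      finally show "\<bar>integral\<^sup>L M f - integral\<^sup>L M G\<bar> \<le> 2 * \<eta>"
        using c_tail by simp
    qed
    have conv: "(\<lambda>n. integral\<^sup>L (\<mu> n) F) \<longlonglongrightarrow> integral\<^sup>L \<nu> F" if "trig_polynomial2 F" for F
      using that
    proof induction
      case (wave s t)
      show ?case by (rule cf)
    next
      case (add F G)
      note int = trig_polynomial2_integrable[OF _ prob_space.finite_measure]
      from add show ?case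
        using int[OF add.hyps(1) \<mu>] int[OF add.hyps(2) \<mu>] int[OF add.hyps(1) \<nu>] int[OF add.hyps(2) \<nu>]
        by (simp add: tendsto_add)
    next
      case (cmult F c)
      then show ?case
        by (simp add: tendsto_mult)
    qed
    have "(\<lambda>n. complex_of_real (integral\<^sup>L (\<mu> n) G)) \<longlonglongrightarrow> complex_of_real (integral\<^sup>L \<nu> G)"
      using conv[OF trig] by (simp add: integral_complex_of_real)
    then have "(\<lambda>n. integral\<^sup>L (\<mu> n) G) \<longlonglongrightarrow> integral\<^sup>L \<nu> G"
      by (simp add: tendsto_of_real_iff)
    then have "eventually (\<lambda>n. dist (integral\<^sup>L (\<mu> n) G) (integral\<^sup>L \<nu> G) < \<eta>) sequentially"
      using \<eta> by (rule tendstoD)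
    with mom_\<mu> show "eventually (\<lambda>n. dist (integral\<^sup>L (\<mu> n) f) (integral\<^sup>L \<nu> f) < \<epsilon>) sequentially"
    proof eventually_elim
      case (elim n)
      have "\<bar>integral\<^sup>L (\<mu> n) f - integral\<^sup>L (\<mu> n) G\<bar> \<le> 2 * \<eta>"
        using elim(1) by (intro close(2) \<mu>) auto
      with elim(2) close(2)[OF \<nu> mom_\<nu>] show ?case
        unfolding \<eta>_def dist_real_def by linarith
    qed
  qed
qed

section \<open>Moments and characteristic function of the limit\<close>

lemma prob_space_std_normal2: "prob_space std_normal2" "sets std_normal2 = sets borel"
proof -
  interpret N: prob_space std_normal_distribution
    by (rule prob_space_normal_density) simp
  interpret pair_prob_space std_normal_distribution std_normal_distribution ..
  show "prob_space std_normal2"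
    unfolding std_normal2_eq_pair by (rule P.prob_space_axioms)
  show "sets std_normal2 = sets borel"
    by (simp add: std_normal2_def)
qed

lemma cf_std_normal2:
  "(\<integral>p. iexp (s * fst p + t * snd p) \<partial>std_normal2) = exp (- (s\<^sup>2 / 2)) * exp (- (t\<^sup>2 / 2))"
proof -
  interpret N: prob_space std_normal_distribution
    by (rule prob_space_normal_density) simp
  interpret pair_prob_space std_normal_distribution std_normal_distribution ..
  have char: "(\<integral>x. iexp (s * x) \<partial>std_normal_distribution) = exp (- (s\<^sup>2 / 2))" for s
    using fun_cong[OF char_std_normal_distribution, of s] by (simp add: char_def)
  have "integrable std_normal2 (\<lambda>p. iexp (s * fst p + t * snd p))"
    using prob_space_std_normal2
    by (intro trig_polynomial2_integrable trig_polynomial2.wave prob_space.finite_measure)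
  then have "(\<integral>p. iexp (s * fst p + t * snd p) \<partial>std_normal2) =
      (\<integral>x. (\<integral>y. iexp (s * x + t * y) \<partial>std_normal_distribution) \<partial>std_normal_distribution)"
    unfolding std_normal2_eq_pair by (subst integral_fst'[symmetric]) auto
  also have "\<dots> = exp (- (s\<^sup>2 / 2)) * exp (- (t\<^sup>2 / 2))"
    unfolding iexp_add by (simp only: integral_mult_left_zero integral_mult_right_zero char) simp
  finally show ?thesis .
qed

lemma second_moment_std_normal2:
  "integrable std_normal2 (\<lambda>p. (norm p)\<^sup>2)" "(\<integral>p. (norm p)\<^sup>2 \<partial>std_normal2) = 2"
proof -
  interpret N: prob_space std_normal_distribution
    by (rule prob_space_normal_density) simp
  interpret pair_prob_space std_normal_distribution std_normal_distribution ..
  have one: "integrable std_normal_distribution (\<lambda>x. x\<^sup>2)" "(\<integral>x. x\<^sup>2 \<partial>std_normal_distribution) = 1"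
    using integrable_std_normal_moment[of 2] integral_std_normal_moment_even[of 1]
    by (simp_all add: integrable_density integral_density normal_density_nonneg)
  let ?N2 = "std_normal_distribution \<Otimes>\<^sub>M std_normal_distribution"
  have marginal: "distr ?N2 std_normal_distribution fst = std_normal_distribution"
    by (rule N.distr_pair_fst)
  have fst: "integrable ?N2 (\<lambda>p. (fst p)\<^sup>2)" "(\<integral>p. (fst p)\<^sup>2 \<partial>?N2) = 1"
    using one integrable_distr_eq[of fst ?N2 std_normal_distribution "\<lambda>x. x\<^sup>2"]
      integral_distr[of fst ?N2 std_normal_distribution "\<lambda>x. x\<^sup>2"]
    unfolding marginal by simp_all
  have snd: "integrable ?N2 (\<lambda>p. (snd p)\<^sup>2)" "(\<integral>p. (snd p)\<^sup>2 \<partial>?N2) = 1"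
    using integrable_product_swap[OF fst(1)] integral_product_swap[of "\<lambda>p. (fst p)\<^sup>2"] fst(2)
    by (simp_all add: case_prod_unfold)
  have "(norm p)\<^sup>2 = (fst p)\<^sup>2 + (snd p)\<^sup>2" for p :: "real \<times> real"
    by (simp add: norm_prod_def)
  then show "integrable std_normal2 (\<lambda>p. (norm p)\<^sup>2)" "(\<integral>p. (norm p)\<^sup>2 \<partial>std_normal2) = 2"
    unfolding std_normal2_eq_pair using fst snd by simp_all
qed

section \<open>Joint asymptotic normality\<close>

text \<open>
  The rescaling \<open>r = s/\<sigma>\<close> makes every error term of order \<open>1/\<surd>n\<close>, because \<open>1/\<sigma> \<le> 5/\<surd>n\<close>
  and a transposition changes the weight \<open>exp(\<i> t S'/\<sigma>)\<close> by \<open>O(|t|/(\<sigma> n))\<close> on average.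
\<close>

lemma perm_avg_iexp_gaussian_approx:
  fixes s t \<sigma> :: real
  assumes n: "n \<ge> 4" and \<sigma>: "\<sigma>\<^sup>2 = 2 * (real n + 1) / 45" "\<sigma> > 0"
  shows "norm (perm_avg n (\<lambda>\<pi>. iexp (s * (peak_sum n \<pi> / \<sigma>)) * iexp (t * (peak_sum n (inv \<pi>) / \<sigma>)))
      - exp (- (s\<^sup>2 / 2)) * perm_avg n (\<lambda>\<pi>. iexp (t * (peak_sum n (inv \<pi>) / \<sigma>))))
    \<le> (5 * \<bar>s\<bar> * (40 * \<bar>t\<bar> + 325 * s\<^sup>2 + 815 * \<bar>s\<bar>)) / sqrt n"
proof -
  define g where "g \<pi> = iexp (t * (peak_sum n (inv \<pi>) / \<sigma>))" for \<pi>
  have g_eq: "g = (\<lambda>\<pi>. iexp (t / \<sigma> * peak_sum n (inv \<pi>)))"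
    by (simp add: g_def fun_eq_iff)
  define \<delta> where "\<delta> = 4 * \<bar>t / \<sigma>\<bar> / (real n - 1)"
  define r where "r = s / \<sigma>"
  have sn: "sqrt n \<ge> 1"
    using n by simp
  have "(sqrt n / 5)\<^sup>2 = real n / 25"
    by (simp add: power_divide)
  also have "\<dots> \<le> \<sigma>\<^sup>2"
    unfolding \<sigma>(1) by simp
  finally have "sqrt n / 5 \<le> \<sigma>"
    using \<sigma>(2) by (rule power2_le_imp_le[OF _ less_imp_le])
  then have "1 / \<sigma> \<le> 1 / (sqrt n / 5)"
    using n by (intro frac_le) auto
  then have inv_\<sigma>: "1 / \<sigma> \<le> 5 / sqrt n"
    by simp
  have div_le: "\<bar>x / \<sigma>\<bar> \<le> 5 * \<bar>x\<bar> / sqrt n" for x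
    using mult_left_mono[OF inv_\<sigma>, of "\<bar>x\<bar>"] \<sigma>(2) by (simp add: mult_ac)
  have approx: "norm (peak_cf n g r - exp (- (2 * (real n + 1) / 45 * r\<^sup>2 / 2)) * perm_avg n g)
      \<le> (real n * \<delta> + 13 * real n * r\<^sup>2 + 163 * sqrt n * \<bar>r\<bar>) * \<bar>r\<bar>"
    unfolding g_eq \<delta>_def
    by (intro peak_cf_gaussian_approx n perm_avg_inv_cf_transpose_diff) auto
  have "real n * \<delta> \<le> 40 * \<bar>t\<bar>"
  proof -
    have "real n / (real n - 1) \<le> 2"
      using n by (simp add: field_simps)
    moreover have "\<bar>t / \<sigma>\<bar> \<le> 5 * \<bar>t\<bar>"
    proof -
      have "5 * \<bar>t\<bar> / sqrt n \<le> 5 * \<bar>t\<bar> / 1"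
        using sn by (intro divide_left_mono) auto
      then show ?thesis
        using div_le[of t] by linarith
    qed
    ultimately have "(real n / (real n - 1)) * (4 * \<bar>t / \<sigma>\<bar>) \<le> 2 * (4 * (5 * \<bar>t\<bar>))"
      by (intro mult_mono) auto
    then show ?thesis
      by (simp add: \<delta>_def mult_ac)
  qed
  moreover have "13 * real n * r\<^sup>2 \<le> 325 * s\<^sup>2"
  proof -
    have "\<bar>r\<bar>\<^sup>2 \<le> (5 * \<bar>s\<bar> / sqrt n)\<^sup>2"
      unfolding r_def by (intro power_mono div_le) auto
    also have "\<dots> = 25 * s\<^sup>2 / n"
      by (simp add: power_divide power_mult_distrib)
    finally show ?thesis
      using n by (simp add: field_simps)
  qed
  moreover have "163 * sqrt n * \<bar>r\<bar> \<le> 815 * \<bar>s\<bar>"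
    using mult_left_mono[OF div_le[of s], of "163 * sqrt n"] n by (simp add: r_def)
  ultimately have "real n * \<delta> + 13 * real n * r\<^sup>2 + 163 * sqrt n * \<bar>r\<bar> \<le> 40 * \<bar>t\<bar> + 325 * s\<^sup>2 + 815 * \<bar>s\<bar>"
    by linarith
  moreover have "\<bar>r\<bar> \<le> 5 * \<bar>s\<bar> / sqrt n"
    unfolding r_def by (rule div_le)
  ultimately have error: "(real n * \<delta> + 13 * real n * r\<^sup>2 + 163 * sqrt n * \<bar>r\<bar>) * \<bar>r\<bar>
      \<le> (40 * \<bar>t\<bar> + 325 * s\<^sup>2 + 815 * \<bar>s\<bar>) * (5 * \<bar>s\<bar> / sqrt n)"
    by (rule mult_mono) auto
  have variance: "2 * (real n + 1) / 45 * r\<^sup>2 / 2 = s\<^sup>2 / 2"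
    unfolding \<sigma>(1)[symmetric] r_def using \<sigma>(2) by (simp add: power_divide)
  have "norm (peak_cf n g r - exp (- (s\<^sup>2 / 2)) * perm_avg n g)
      \<le> (40 * \<bar>t\<bar> + 325 * s\<^sup>2 + 815 * \<bar>s\<bar>) * (5 * \<bar>s\<bar> / sqrt n)"
    by (rule order.trans[OF approx[unfolded variance] error])
  moreover have "peak_cf n g r = perm_avg n (\<lambda>\<pi>. iexp (s * (peak_sum n \<pi> / \<sigma>)) * g \<pi>)"
    by (simp add: peak_cf_def r_def)
  ultimately show ?thesis
    unfolding g_def[symmetric] by (simp only: mult_ac times_divide_eq_right times_divide_eq_left)
qed

text \<open>
  The approximation is used twice: for \<open>(s, t)\<close>, to split off the factor of the first coordinate, and
  for \<open>(t, 0)\<close>, to find the limit of the remaining characteristic function of the second coordinate, which is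
  distributed like the first.
\<close>

lemma peak_cf_limit:
  fixes \<sigma> :: "nat \<Rightarrow> real"
  assumes \<sigma>: "\<And>n. (\<sigma> n)\<^sup>2 = 2 * (real n + 1) / 45" "\<And>n. \<sigma> n > 0"
  shows "(\<lambda>n. perm_avg n (\<lambda>\<pi>. iexp (s * (peak_sum n \<pi> / \<sigma> n)) * iexp (t * (peak_sum n (inv \<pi>) / \<sigma> n))))
    \<longlonglongrightarrow> exp (- (s\<^sup>2 / 2)) * exp (- (t\<^sup>2 / 2))"
proof -
  have step: "(\<lambda>n. perm_avg n (\<lambda>\<pi>. iexp (s * (peak_sum n \<pi> / \<sigma> n)) * iexp (t * (peak_sum n (inv \<pi>) / \<sigma> n)))
      - of_real (exp (- (s\<^sup>2 / 2))) * perm_avg n (\<lambda>\<pi>. iexp (t * (peak_sum n (inv \<pi>) / \<sigma> n)))) \<longlonglongrightarrow> 0" for s t :: real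
  proof (rule Lim_null_comparison)
    show "eventually (\<lambda>n. norm (perm_avg n (\<lambda>\<pi>. iexp (s * (peak_sum n \<pi> / \<sigma> n)) * iexp (t * (peak_sum n (inv \<pi>) / \<sigma> n)))
      - of_real (exp (- (s\<^sup>2 / 2))) * perm_avg n (\<lambda>\<pi>. iexp (t * (peak_sum n (inv \<pi>) / \<sigma> n))))
      \<le> (5 * \<bar>s\<bar> * (40 * \<bar>t\<bar> + 325 * s\<^sup>2 + 815 * \<bar>s\<bar>)) / sqrt n) sequentially"
      using eventually_ge_at_top[of 4]
      by eventually_elim (rule perm_avg_iexp_gaussian_approx[OF _ \<sigma>])
    show "(\<lambda>n. (5 * \<bar>s\<bar> * (40 * \<bar>t\<bar> + 325 * s\<^sup>2 + 815 * \<bar>s\<bar>)) / sqrt (real n)) \<longlonglongrightarrow> 0"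
      by (intro real_tendsto_divide_at_top[OF tendsto_const] filterlim_compose[OF sqrt_at_top]
          filterlim_real_sequentially)
  qed
  have "(\<lambda>n. perm_avg n (\<lambda>\<pi>. iexp (t * (peak_sum n (inv \<pi>) / \<sigma> n)))) \<longlonglongrightarrow> exp (- (t\<^sup>2 / 2))"
  proof -
    have "perm_avg n (\<lambda>\<pi>. iexp (t * (peak_sum n (inv \<pi>) / \<sigma> n))) = perm_avg n (\<lambda>\<pi>. iexp (t * (peak_sum n \<pi> / \<sigma> n)))" for n
      by (rule perm_avg_inv)
    then show ?thesis
      using step[of t 0] by (simp add: perm_avg_const LIM_zero_iff)
  qed
  from tendsto_add[OF step[of s t] tendsto_mult_left[OF this, of "of_real (exp (- (s\<^sup>2 / 2)))"]]
  show ?thesis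
    by simp
qed

lemma peak_sum_eq_pk:
  assumes "n \<ge> 2"
  shows "peak_sum n \<pi> = real (pk n \<pi>) + 1 - (real n + 1) / 3"
proof -
  have "(\<Sum>i\<in>{2..n - 1}. of_bool (i \<in> peaks n \<pi>)) = real (pk n \<pi>)"
    unfolding pk_def by (subst sum_of_bool_eq) (auto simp: peaks_def intro!: arg_cong[where f = card])
  then show ?thesis
    unfolding peak_sum_def peak_dev_def sum_subtractf using assms
    by (simp add: of_nat_diff field_simps)
qed

theorem theorem2:
  fixes M M' :: "nat \<Rightarrow> (nat \<Rightarrow> nat) \<Rightarrow> real" and \<mu> \<sigma> :: "nat \<Rightarrow> real"
  assumes "\<And>n \<pi>. M n \<pi> = real (pk n \<pi>) + 1"
    and "\<And>n \<pi>. M' n \<pi> = real (pk n (inv \<pi>)) + 1"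
    and "\<And>n. \<mu> n = (real n + 1) / 3"
    and "\<And>n. (\<sigma> n)\<^sup>2 = 2 * (real n + 1) / 45"
    and "\<And>n. \<sigma> n > 0"
  shows "weak_conv_meas
    (\<lambda>n. distr (uniform_perm n) borel
       (\<lambda>\<pi>. ((M n \<pi> - \<mu> n) / \<sigma> n, (M' n \<pi> - \<mu> n) / \<sigma> n)))
    std_normal2"
proof (rule levy_continuity_plane[where C = 2])
  let ?X = "\<lambda>n \<pi>. ((M n \<pi> - \<mu> n) / \<sigma> n, (M' n \<pi> - \<mu> n) / \<sigma> n)"
  let ?D = "\<lambda>n. distr (uniform_perm n) borel (?X n)"
  have X: "?X n \<pi> = (peak_sum n \<pi> / \<sigma> n, peak_sum n (inv \<pi>) / \<sigma> n)" if "n \<ge> 4" for n \<pi>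
    using that by (simp add: peak_sum_eq_pk assms(1-3))
  have int: "integrable (?D n) F" "integral\<^sup>L (?D n) F = perm_avg n (\<lambda>\<pi>. F (?X n \<pi>))"
    if "F \<in> borel_measurable borel" for n and F :: "real \<times> real \<Rightarrow> 'b::{banach,second_countable_topology}"
    using that by (simp_all add: integrable_distr_eq integral_distr integral_uniform_perm)
  show "prob_space (?D n)" for n
    by (intro prob_space.prob_space_distr prob_space_measure_pmf) simp
  show "(\<lambda>n. \<integral>p. iexp (s * fst p + t * snd p) \<partial>?D n) \<longlonglongrightarrow> (\<integral>p. iexp (s * fst p + t * snd p) \<partial>std_normal2)" for s t
  proof -
    have meas: "(\<lambda>p. iexp (s * fst p + t * snd p)) \<in> borel_measurable borel"
      by (intro borel_measurable_continuous_onI continuous_intros)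
    have "eventually (\<lambda>n. perm_avg n (\<lambda>\<pi>. iexp (s * (peak_sum n \<pi> / \<sigma> n)) * iexp (t * (peak_sum n (inv \<pi>) / \<sigma> n)))
        = (\<integral>p. iexp (s * fst p + t * snd p) \<partial>?D n)) sequentially"
      using eventually_ge_at_top[of 4]
    proof eventually_elim
      case (elim n)
      have "(\<integral>p. iexp (s * fst p + t * snd p) \<partial>?D n) = perm_avg n (\<lambda>\<pi>. iexp (s * fst (?X n \<pi>) + t * snd (?X n \<pi>)))"
        by (rule int(2)[OF meas])
      then show ?case
        by (simp only: X[OF elim] fst_conv snd_conv iexp_add)
    qed
    from Lim_transform_eventually[OF peak_cf_limit[OF assms(4,5)] this] show ?thesis
      unfolding cf_std_normal2 .
  qed
  show "eventually (\<lambda>n. integrable (?D n) (\<lambda>p. (norm p)\<^sup>2) \<and> (\<integral>p. (norm p)\<^sup>2 \<partial>?D n) \<le> 2) sequentially"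
    using eventually_ge_at_top[of 4]
  proof eventually_elim
    case (elim n)
    have meas: "(\<lambda>p :: real \<times> real. (norm p)\<^sup>2) \<in> borel_measurable borel"
      by measurable
    have "(norm (?X n \<pi>))\<^sup>2 = (1 / (\<sigma> n)\<^sup>2) * ((peak_sum n \<pi>)\<^sup>2 + (peak_sum n (inv \<pi>))\<^sup>2)" for \<pi>
      unfolding X[OF elim] by (simp add: norm_Pair power_divide add_divide_distrib)
    then have "(\<integral>p. (norm p)\<^sup>2 \<partial>?D n) = (1 / (\<sigma> n)\<^sup>2) * (perm_avg n (\<lambda>\<pi>. (peak_sum n \<pi>)\<^sup>2) + perm_avg n (\<lambda>\<pi>. (peak_sum n (inv \<pi>))\<^sup>2))"
      by (simp only: int(2)[OF meas] perm_avg_cmult perm_avg_add)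
    also have "perm_avg n (\<lambda>\<pi>. (peak_sum n (inv \<pi>))\<^sup>2) = perm_avg n (\<lambda>\<pi>. (peak_sum n \<pi>)\<^sup>2)"
      by (rule perm_avg_inv)
    also have "perm_avg n (\<lambda>\<pi>. (peak_sum n \<pi>)\<^sup>2) = (\<sigma> n)\<^sup>2"
      by (simp only: perm_avg_peak_sum_sq[OF elim] assms(4))
    also have "(1 / (\<sigma> n)\<^sup>2) * ((\<sigma> n)\<^sup>2 + (\<sigma> n)\<^sup>2) = 2"
      using assms(5)[of n] by simp
    finally show ?case
      using int(1)[OF meas] by simp
  qed
qed (simp_all add: prob_space_std_normal2 second_moment_std_normal2)

end
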